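(* There exists a $3$-generator polynomial semigroup $G=\langle h_1,h_2,h_3\rangle$ in $\mathcal G_{dis}$ such that $\bigcup_{j=1}^2(h_j)^{-1}(J_{\max}(G))\subset J_{\min}(G)$, $J_{\max}(G)=J(h_3)$, $\sharp(\hat{\mathcal J}_G)=\aleph_0$, there exists a superattracting fixed point $z_0$ of some element of $G$ with $z_0\in J(G)$, and $\mathrm{int}(J_{\min}(G))\ne\emptyset$.
   Context: $\hat{\mathbb C}$ is the Riemann sphere. A polynomial semigroup is a semigroup (under composition) generated by a family of non-constant polynomial maps on $\hat{\mathbb C}$; $\langle h_1,h_2,h_3\rangle$ is the semigroup generated by $h_1,h_2,h_3$. The Fatou set $F(G)$ is the set of $z\in\hat{\mathbb C}$ having a neighborhood on which $G$ is a normal family; the Julia set is $J(G)=\hat{\mathbb C}\setminus F(G)$; $J(g)$ is the Julia set of the semigroup generated by $g$. $P(G)=\overline{\bigcup_{g\in G}\{\text{critical values of } g:\hat{\mathbb C}\to\hat{\mathbb C}\}}$ and $P^{*}(G)=P(G)\setminus\{\infty\}$. $\mathcal G$ is the set of polynomial semigroups $G$ all of whose elements have degree at least two and for which $P^{*}(G)$ is bounded in $\mathbb C$; $\mathcal G_{dis}=\{G\in\mathcal G:J(G)\text{ disconnected}\}$. $\hat{\mathcal J}_G$ is the set of all connected components of $J(G)$ and $\mathcal J_G$ the set of those contained in $\mathbb C$. For connected sets $K_1,K_2\subset\mathbb C$, $K_1\le K_2$ means $K_1=K_2$ or $K_1$ is contained in a bounded component of $\mathbb C\setminus K_2$. For $G\in\mathcal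 G_{dis}$, $J_{\min}(G)$ and $J_{\max}(G)$ denote the unique elements of $\mathcal J_G$ with $J_{\min}(G)\le J\le J_{\max}(G)$ for all $J\in\mathcal J_G$ (they exist). *)

theory Defs
  imports "HOL-Complex_Analysis.Complex_Analysis" "HOL-Library.Equipollence"
begin

datatype riemann_sphere = Pt complex | Infty

primrec stereo :: "riemann_sphere \<Rightarrow> complex \<times> real" where
  "stereo (Pt z) = ((2 / (1 + (cmod z)\<^sup>2)) *\<^sub>R z, ((cmod z)\<^sup>2 - 1) / ((cmod z)\<^sup>2 + 1))"
| "stereo Infty = (0, 1)"

lemma stereo_snd_lt: "((cmod z)\<^sup>2 - 1) / ((cmod z)\<^sup>2 + 1) < 1"
  by (simp add: divide_less_eq add_nonneg_pos)

lemma inj_stereo: "inj stereo"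
proof (rule injI)
  fix x y assume eq: "stereo x = stereo y"
  show "x = y"
  proof (cases x; cases y)
    fix z w assume xy: "x = Pt z" "y = Pt w"
    have pos: "(cmod z)\<^sup>2 + 1 > 0" "(cmod w)\<^sup>2 + 1 > 0"
      by (simp_all add: add_nonneg_pos)
    have "((cmod z)\<^sup>2 - 1) / ((cmod z)\<^sup>2 + 1) = ((cmod w)\<^sup>2 - 1) / ((cmod w)\<^sup>2 + 1)"
      using eq xy by simp
    then have "((cmod z)\<^sup>2 - 1) * ((cmod w)\<^sup>2 + 1) = ((cmod w)\<^sup>2 - 1) * ((cmod z)\<^sup>2 + 1)"
      using pos by (simp add: frac_eq_eq)
    then have sq: "(cmod z)\<^sup>2 = (cmod w)\<^sup>2"
      by (simp add: algebra_simps)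
    have "(2 / (1 + (cmod z)\<^sup>2)) *\<^sub>R z = (2 / (1 + (cmod z)\<^sup>2)) *\<^sub>R w"
      using eq xy sq by simp
    moreover have "2 / (1 + (cmod z)\<^sup>2) \<noteq> 0"
      using pos(1) by (simp add: add.commute)
    ultimately have "z = w"
      by (metis scaleR_cancel_left)
    then show "x = y" using xy by simp
  qed (use eq stereo_snd_lt in \<open>auto simp: less_le\<close>)
qed

text \<open>The topology and the uniformity are those of the chordal metric, i.e. the Euclidean
  distance between the images under stereographic projection to the unit sphere in
  \<open>\<complex> \<times> \<real>\<close>.\<close>

instantiation riemann_sphere :: metric_space
begin

definition dist_riemann_sphere :: "riemann_sphere \<Rightarrow> riemann_sphere \<Rightarrow> real" where
  "dist_riemann_sphere x y = dist (stereo x) (stereo y)"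

definition uniformity_riemann_sphere :: "(riemann_sphere \<times> riemann_sphere) filter" where
  "uniformity_riemann_sphere = (INF e\<in>{0<..}. principal {(x, y). dist x y < e})"

definition open_riemann_sphere :: "riemann_sphere set \<Rightarrow> bool" where
  "open_riemann_sphere U \<longleftrightarrow>
     (\<forall>x\<in>U. eventually (\<lambda>(x', y). x' = x \<longrightarrow> y \<in> U) uniformity)"

instance
proof
  fix x y z :: riemann_sphere
  show "dist x y = 0 \<longleftrightarrow> x = y"
    using inj_stereo by (simp add: dist_riemann_sphere_def inj_eq)
  show "dist x y \<le> dist x z + dist y z"
    by (simp add: dist_riemann_sphere_def dist_triangle2)
qed (simp_all add: uniformity_riemann_sphere_def open_riemann_sphere_def)

end

text \<open>Polynomial maps are represented by their polynomials; over the complex numbers this is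
  faithful, and composition of maps corresponds to \<open>pcompose\<close>.  The value at infinity below
  is the right one for non-constant polynomials, the only ones considered.\<close>

primrec sphere_map :: "complex poly \<Rightarrow> riemann_sphere \<Rightarrow> riemann_sphere" where
  "sphere_map p (Pt z) = Pt (poly p z)"
| "sphere_map p Infty = Infty"

inductive_set semigroup_generated :: "complex poly set \<Rightarrow> complex poly set"
  for H :: "complex poly set" where
  generator: "h \<in> H \<Longrightarrow> h \<in> semigroup_generated H"
| compose: "f \<in> semigroup_generated H \<Longrightarrow> g \<in> semigroup_generated H \<Longrightarrow>
    f \<circ>\<^sub>p g \<in> semigroup_generated H"

definition polynomial_semigroup :: "complex poly set \<Rightarrow> bool" where
  "polynomial_semigroup G \<longleftrightarrow>
     (\<exists>H. H \<noteq> {} \<and> (\<forall>h\<in>H. degree h > 0) \<and> G = semigroup_generated H)"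

definition normal_family_on ::
    "riemann_sphere set \<Rightarrow> (riemann_sphere \<Rightarrow> riemann_sphere) set \<Rightarrow> bool" where
  "normal_family_on U F \<longleftrightarrow>
     (\<forall>f. range f \<subseteq> F \<longrightarrow>
        (\<exists>r l. strict_mono (r :: nat \<Rightarrow> nat) \<and>
           (\<forall>K. compact K \<longrightarrow> K \<subseteq> U \<longrightarrow> uniform_limit K (\<lambda>n. f (r n)) l sequentially)))"

definition fatou_set :: "complex poly set \<Rightarrow> riemann_sphere set" where
  "fatou_set G = {z. \<exists>U. open U \<and> z \<in> U \<and> normal_family_on U (sphere_map ` G)}"

definition julia_set :: "complex poly set \<Rightarrow> riemann_sphere set" where
  "julia_set G = UNIV - fatou_set G"

abbreviation julia_set_of :: "complex poly \<Rightarrow> riemann_sphere set" where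
  "julia_set_of g \<equiv> julia_set (semigroup_generated {g})"

text \<open>At infinity the derivative is taken in the coordinate \<open>w = 1/z\<close>, in which a non-constant
  polynomial \<open>g\<close> becomes \<open>w \<mapsto> 1/g(1/w)\<close> with \<open>0 \<mapsto> 0\<close>.\<close>

fun critical_point :: "complex poly \<Rightarrow> riemann_sphere \<Rightarrow> bool" where
  "critical_point g (Pt z) \<longleftrightarrow> poly (pderiv g) z = 0"
| "critical_point g Infty \<longleftrightarrow>
     ((\<lambda>w. if w = 0 then 0 else inverse (poly g (inverse w))) has_field_derivative 0) (at 0)"

definition critical_values :: "complex poly \<Rightarrow> riemann_sphere set" where
  "critical_values g = sphere_map g ` {z. critical_point g z}"

definition postcritical_set :: "complex poly set \<Rightarrow> riemann_sphere set" where
  "postcritical_set G = closure (\<Union>g\<in>G. critical_values g)"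

definition planar_postcritical_set :: "complex poly set \<Rightarrow> riemann_sphere set" where
  "planar_postcritical_set G = postcritical_set G - {Infty}"

text \<open>At a fixed point the derivative used in \<open>critical_point\<close> is the multiplier.\<close>

definition superattracting_fixed_point :: "complex poly \<Rightarrow> riemann_sphere \<Rightarrow> bool" where
  "superattracting_fixed_point g z \<longleftrightarrow> sphere_map g z = z \<and> critical_point g z"

text \<open>Boundedness in \<open>\<complex>\<close> refers to the Euclidean metric (every subset of the sphere is bounded
  in the chordal metric), hence the preimage under \<open>Pt\<close>.\<close>

definition postcritically_bounded_semigroups :: "complex poly set set" where
  "postcritically_bounded_semigroups =
     {G. polynomial_semigroup G \<and> (\<forall>g\<in>G. degree g \<ge> 2) \<and>
         bounded (Pt -` planar_postcritical_set G)}"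

definition G_dis :: "complex poly set set" where
  "G_dis = {G \<in> postcritically_bounded_semigroups. \<not> connected (julia_set G)}"

definition julia_components :: "complex poly set \<Rightarrow> riemann_sphere set set" where
  "julia_components G = components (julia_set G)"

definition planar_julia_components :: "complex poly set \<Rightarrow> riemann_sphere set set" where
  "planar_julia_components G = {J \<in> julia_components G. J \<subseteq> range Pt}"

text \<open>Intended for connected subsets of the plane.  Components and boundedness are those of the
  plane, not of the sphere.\<close>

definition surrounded_by :: "riemann_sphere set \<Rightarrow> riemann_sphere set \<Rightarrow> bool" where
  "surrounded_by K1 K2 \<longleftrightarrow>
     K1 = K2 \<or> (\<exists>C \<in> components (UNIV - Pt -` K2). bounded C \<and> K1 \<subseteq> Pt ` C)"

definition J_min :: "complex poly set \<Rightarrow> riemann_sphere set" where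
  "J_min G = (THE J. J \<in> planar_julia_components G \<and>
                (\<forall>J'\<in>planar_julia_components G. surrounded_by J J'))"

definition J_max :: "complex poly set \<Rightarrow> riemann_sphere set" where
  "J_max G = (THE J. J \<in> planar_julia_components G \<and>
                (\<forall>J'\<in>planar_julia_components G. surrounded_by J' J))"

end

theory Submission
  imports Defs "HOL-Computational_Algebra.Fundamental_Theorem_Algebra"
begin

text \<open>Take \<open>h\<^sub>1 = 3 z\<^sup>2 - 2 z\<^sup>3\<close>, \<open>h\<^sub>2 = z^32\<close> and \<open>h\<^sub>3 = z^5 / 256\<close>, so that \<open>J(h\<^sub>2)\<close> and \<open>J(h\<^sub>3)\<close>
  are the circles of radius 1 and 4.  All three maps preserve \<open>[0, 1]\<close>, which contains their
  finite critical values, so \<open>P\<^sup>*(G) \<subseteq> [0, 1]\<close>.  On the complement of the closure of the preimages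
  of the circle \<open>\<bar>z\<bar> = 4\<close> every element of \<open>G\<close> omits this circle, hence Montel's theorem for
  bounded families shows that this closure is \<open>J(G)\<close>.

  Since \<open>[0, 3/2]\<close> contains a full fibre of \<open>h\<^sub>1\<close>, all sets \<open>\<bar>g\<bar> < 4\<close> are connected, and by
  unicoherence of the plane so are the level sets \<open>\<bar>g\<bar> = 4\<close>.  Those of \<open>g \<circ> h\<^sub>1\<close> cross those of
  \<open>g' \<circ> h\<^sub>2\<close>, so that their union is connected; its closure is the part of \<open>J(G)\<close> in \<open>\<bar>z\<bar> \<le> 2\<close>
  and equals \<open>J\<^sub>m\<^sub>i\<^sub>n\<close>.  The remaining components are its preimages under the iterates of \<open>h\<^sub>3\<close>,
  nested in disjoint round annuli, and their limit \<open>J(h\<^sub>3)\<close>.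

  The point 1 is a superattracting fixed point of \<open>h\<^sub>1\<close> on \<open>J(h\<^sub>2)\<close>.  As \<open>J\<^sub>m\<^sub>i\<^sub>n\<close> is a continuum
  through 1 and \<open>J(G)\<close> is backward invariant, the preimages of \<open>J\<^sub>m\<^sub>i\<^sub>n\<close> under the iterates of \<open>h\<^sub>1\<close> are
  dense near 1, so 1 is an interior point.\<close>

section \<open>The Riemann sphere and normal families\<close>

lemma continuous_on_stereo: "continuous_on S stereo"
  unfolding continuous_on_iff by (auto simp: dist_riemann_sphere_def)

lemma continuous_on_Pt: "continuous_on S Pt"
proof -
  have "continuous_on S (\<lambda>z. stereo (Pt z))"
    by (auto intro!: continuous_intros simp: add_nonneg_eq_0_iff)
  then show ?thesis
    unfolding continuous_on_iff by (simp add: dist_riemann_sphere_def)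
qed

definition plane_coord :: "riemann_sphere \<Rightarrow> complex" where
  "plane_coord x = inverse (1 - snd (stereo x)) *\<^sub>R fst (stereo x)"

lemma plane_coord_Pt [simp]: "plane_coord (Pt z) = z"
proof -
  have "(cmod z)\<^sup>2 + 1 > 0" by (simp add: add_nonneg_pos)
  then have "inverse (1 - ((cmod z)\<^sup>2 - 1) / ((cmod z)\<^sup>2 + 1)) * (2 / (1 + (cmod z)\<^sup>2)) = 1"
    by (simp add: field_simps)
  then show ?thesis
    by (simp add: plane_coord_def)
qed

lemma range_Pt: "range Pt = - {Infty}"
proof -
  have "x \<in> range Pt" if "x \<noteq> Infty" for x using that by (cases x) auto
  then show ?thesis by auto
qed

lemma continuous_on_plane_coord: "continuous_on (range Pt) plane_coord"
proof -
  have "snd (stereo x) \<noteq> 1" if "x \<in> range Pt" for x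
    using that stereo_snd_lt by (auto simp: less_le)
  then show ?thesis unfolding plane_coord_def
    by (intro continuous_intros continuous_on_stereo) auto
qed

lemma open_Pt_image: "open S \<Longrightarrow> open (Pt ` S)"
proof -
  assume S: "open S"
  have "open (range Pt)" by (simp add: range_Pt open_Compl)
  then have "open (plane_coord -` S \<inter> range Pt)"
    using continuous_on_plane_coord continuous_on_open_vimage S by blast
  moreover have "plane_coord -` S \<inter> range Pt = Pt ` S" by auto
  ultimately show ?thesis by simp
qed

text \<open>The map \<open>z \<mapsto> 1/z\<close>, an isometry of the sphere; composed with \<open>Pt\<close> it is the chart
  at infinity.\<close>

fun sphere_inv :: "riemann_sphere \<Rightarrow> riemann_sphere" where
  "sphere_inv (Pt z) = (if z = 0 then Infty else Pt (inverse z))"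
| "sphere_inv Infty = Pt 0"

lemma sphere_inv_sphere_inv [simp]: "sphere_inv (sphere_inv x) = x"
  by (cases x) auto

text \<open>On the unit sphere, \<open>z \<mapsto> 1/z\<close> is the half turn about the real axis:
  it conjugates the horizontal coordinate and reverses the height.\<close>

lemma stereo_sphere_inv: "stereo (sphere_inv x) = (cnj (fst (stereo x)), - snd (stereo x))"
proof (cases x)
  case (Pt z)
  show ?thesis
  proof (cases "z = 0")
    case False
    then have q: "(cmod z)\<^sup>2 > 0" by simp
    have "cnj z = of_real ((cmod z)\<^sup>2) * inverse z"
      using False by (simp add: complex_norm_square del: of_real_power)
    moreover have "2 / (1 + inverse ((cmod z)\<^sup>2)) = 2 / (1 + (cmod z)\<^sup>2) * (cmod z)\<^sup>2"
      using q by (simp add: field_simps)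
    moreover have "(inverse ((cmod z)\<^sup>2) - 1) / (inverse ((cmod z)\<^sup>2) + 1)
        = - (((cmod z)\<^sup>2 - 1) / ((cmod z)\<^sup>2 + 1))"
    proof -
      have "inverse q - 1 = (1 - q) / q" "inverse q + 1 = (q + 1) / q" if "q > 0" for q :: real
        using that by (auto simp: field_simps)
      then show ?thesis using q by (simp add: minus_divide_left)
    qed
    ultimately show ?thesis
      using False Pt by (simp add: norm_inverse power_inverse scaleR_conv_of_real)
  qed (use Pt in simp)
qed simp

lemma dist_sphere_inv: "dist (sphere_inv x) (sphere_inv y) = dist x y"
proof -
  have "dist (cnj a) (cnj b) = dist a b" for a b
    by (metis complex_cnj_diff complex_mod_cnj dist_norm)
  moreover have "dist (- a) (- b) = dist a b" for a b :: real
    by (simp add: dist_real_def)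
  ultimately show ?thesis
    by (simp add: dist_riemann_sphere_def stereo_sphere_inv dist_prod_def)
qed

lemma continuous_on_sphere_inv: "continuous_on S sphere_inv"
  unfolding continuous_on_iff by (auto simp: dist_sphere_inv)

lemma open_sphere_inv_image: "open S \<Longrightarrow> open (sphere_inv ` S)"
proof -
  assume "open S"
  moreover have "sphere_inv ` S = sphere_inv -` S"
  proof (intro set_eqI iffI)
    fix x assume "x \<in> sphere_inv -` S"
    then show "x \<in> sphere_inv ` S"
      using image_eqI[of x sphere_inv "sphere_inv x" S] by simp
  qed (auto simp del: sphere_inv.simps)
  ultimately show ?thesis
    using continuous_on_open_vimage[of UNIV sphere_inv] continuous_on_sphere_inv by auto
qed

text \<open>Montel's theorem read in a source chart \<open>e\<close> with inverse \<open>d\<close>.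
  Each map need only be bounded in one of the two target charts \<open>z\<close> and
  \<open>1/z\<close>, since a subsequence keeps to a single one.\<close>

lemma normal_family_on_chart:
  fixes e :: "complex \<Rightarrow> riemann_sphere"
  assumes d: "continuous_on (range e) d" "\<And>z. d (e z) = z"
  assumes F: "\<And>g. g \<in> F \<Longrightarrow> \<exists>\<phi>. \<phi> holomorphic_on ball a r \<and>
      (\<forall>z\<in>ball a r. cmod (\<phi> z) \<le> B) \<and>
      ((\<forall>z\<in>ball a r. g (e z) = Pt (\<phi> z)) \<or>
       (\<forall>z\<in>ball a r. g (e z) = sphere_inv (Pt (\<phi> z))))"
  shows "normal_family_on (e ` ball a r) F"
  unfolding normal_family_on_def
proof (intro allI impI)
  fix f :: "nat \<Rightarrow> riemann_sphere \<Rightarrow> riemann_sphere"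
  assume f: "range f \<subseteq> F"
  define Q where "Q \<phi> g \<longleftrightarrow> \<phi> holomorphic_on ball a r \<and> (\<forall>z\<in>ball a r. cmod (\<phi> z) \<le> B) \<and>
      ((\<forall>z\<in>ball a r. g (e z) = Pt (\<phi> z)) \<or>
       (\<forall>z\<in>ball a r. g (e z) = sphere_inv (Pt (\<phi> z))))" for \<phi> g
  have "\<exists>\<phi>. Q \<phi> (f n)" for n
    unfolding Q_def using f by (intro F) auto
  then obtain \<phi> where \<phi>: "\<And>n. Q (\<phi> n) (f n)" by metis
  then have hol: "\<And>n. \<phi> n holomorphic_on ball a r"
    and bd: "\<And>n z. z \<in> ball a r \<Longrightarrow> cmod (\<phi> n z) \<le> B"
    and cs: "\<And>n. (\<forall>z\<in>ball a r. f n (e z) = Pt (\<phi> n z)) \<or>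
       (\<forall>z\<in>ball a r. f n (e z) = sphere_inv (Pt (\<phi> n z)))" unfolding Q_def by auto
  \<comment> \<open>Pigeonhole: infinitely many \<open>f n\<close> use the same target chart, called
    \<open>e2\<close>.\<close>
  obtain s :: "nat \<Rightarrow> nat" and e2 :: "complex \<Rightarrow> riemann_sphere"
    where s: "strict_mono s" and e2: "continuous_on UNIV e2"
      and fs: "\<And>n z. z \<in> ball a r \<Longrightarrow> f (s n) (e z) = e2 (\<phi> (s n) z)"
  proof -
    define N where "N = {n. \<forall>z\<in>ball a r. f n (e z) = Pt (\<phi> n z)}"
    have "infinite N \<or> infinite (- N)"
      by (metis finite_Un infinite_UNIV_nat Compl_partition)
    then show ?thesis
    proof
      assume "infinite N"
      then obtain s :: "nat \<Rightarrow> nat" where "strict_mono s" "\<And>n. s n \<in> N"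
        using infinite_enumerate by blast
      then show ?thesis using that[of s Pt] continuous_on_Pt by (auto simp: N_def)
    next
      assume "infinite (- N)"
      then obtain s :: "nat \<Rightarrow> nat" where s: "strict_mono s" "\<And>n. s n \<in> - N"
        using infinite_enumerate by blast
      have "\<forall>z\<in>ball a r. f (s n) (e z) = sphere_inv (Pt (\<phi> (s n) z))" for n
        using cs s(2)[of n] unfolding N_def by blast
      moreover have "continuous_on UNIV (\<lambda>z. sphere_inv (Pt z))"
        using continuous_on_compose[OF continuous_on_Pt continuous_on_sphere_inv]
        by (simp add: comp_def)
      ultimately show ?thesis using that[of s "\<lambda>z. sphere_inv (Pt z)"] s(1) by blast
    qed
  qed
  obtain g q where q: "strict_mono (q :: nat \<Rightarrow> nat)"
    and ul: "\<And>K. \<lbrakk>compact K; K \<subseteq> ball a r\<rbrakk> \<Longrightarrow>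
       uniform_limit K ((\<lambda>n. \<phi> (s n)) \<circ> q) g sequentially"
  proof (rule Montel[of "ball a r" "{h. h holomorphic_on ball a r \<and> (\<forall>z\<in>ball a r. cmod (h z) \<le> B)}"
          "\<lambda>n. \<phi> (s n)"])
    show "\<exists>C. \<forall>h\<in>{h. h holomorphic_on ball a r \<and> (\<forall>z\<in>ball a r. cmod (h z) \<le> B)}. \<forall>z\<in>K. cmod (h z) \<le> C"
      if "K \<subseteq> ball a r" for K
      using that by (intro exI[of _ B]) auto
  qed (use hol bd in auto)
  have "uniform_limit K (\<lambda>n. f ((s \<circ> q) n)) (\<lambda>x. e2 (g (d x))) sequentially"
    if K: "compact K" "K \<subseteq> e ` ball a r" for K
  proof -
    have "continuous_on K d"
      using d(1) K(2) by (rule continuous_on_subset[OF _ order_trans]) auto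
    then have dK: "compact (d ` K)"
      using K(1) compact_continuous_image by blast
    have dKs: "d ` K \<subseteq> ball a r" using K(2) d(2) by auto
    have u: "uniform_limit (d ` K) (\<lambda>n. \<phi> (s (q n))) g sequentially"
      using ul[OF dK dKs] by (simp add: comp_def)
    have "uniform_limit (d ` K) (\<lambda>n z. e2 (\<phi> (s (q n)) z)) (\<lambda>z. e2 (g z)) sequentially"
    proof (rule uniform_limit_compose_uniformly_continuous_on[OF u])
      show "uniformly_continuous_on (cball 0 B) e2"
        by (rule compact_uniformly_continuous[OF continuous_on_subset[OF e2]]) auto
      show "\<forall>\<^sub>F n in sequentially. \<forall>z\<in>d ` K. \<phi> (s (q n)) z \<in> cball 0 B"
      proof (intro always_eventually allI ballI)
        fix n z assume "z \<in> d ` K"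
        then have "z \<in> ball a r" using dKs by blast
        then show "\<phi> (s (q n)) z \<in> cball 0 B" using bd by simp
      qed
    qed simp
    moreover have "f ((s \<circ> q) n) x = e2 (\<phi> (s (q n)) (d x))" if xK: "x \<in> K" for n x
    proof -
      obtain z where "z \<in> ball a r" "x = e z" using K(2) xK by blast
      then show ?thesis using fs d(2) by simp
    qed
    ultimately show ?thesis
      unfolding uniform_limit_iff by simp
  qed
  moreover have "strict_mono (s \<circ> q)" using s q by (rule strict_mono_o)
  ultimately show "\<exists>r' l. strict_mono r' \<and> (\<forall>K. compact K \<longrightarrow> K \<subseteq> e ` ball a r \<longrightarrow>
      uniform_limit K (\<lambda>n. f (r' n)) l sequentially)" by blast
qed

text \<open>Arbitrarily near \<open>z\<close> there are points where the maps tend to 0, while at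
  \<open>z\<close> they stay on a circle about 0; so no subsequence converges uniformly near
  \<open>z\<close>.\<close>

lemma julia_set_memI:
  fixes f :: "nat \<Rightarrow> complex poly"
  assumes f: "\<And>n. f n \<in> G" and s: "s > 0" "\<And>n. cmod (poly (f n) z) = s"
    and z: "z \<in> closure {y. (\<lambda>n. poly (f n) y) \<longlonglongrightarrow> 0}"
  shows "Pt z \<in> julia_set G"
proof (rule ccontr)
  assume "Pt z \<notin> julia_set G"
  then obtain U where U: "open U" "Pt z \<in> U" "normal_family_on U (sphere_map ` G)"
    by (auto simp: julia_set_def fatou_set_def)
  have "open (Pt -` U)"
    using U(1) continuous_on_open_vimage[of UNIV Pt] continuous_on_Pt by auto
  then obtain \<epsilon> where \<epsilon>: "\<epsilon> > 0" "cball z \<epsilon> \<subseteq> Pt -` U"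
    using U(2) open_contains_cball by blast
  define K where "K = Pt ` cball z \<epsilon>"
  have K: "compact K" "K \<subseteq> U"
    unfolding K_def using \<epsilon> by (auto intro!: compact_continuous_image continuous_on_Pt)
  define F where "F n = sphere_map (f n)" for n
  have "range F \<subseteq> sphere_map ` G" using f by (auto simp: F_def)
  with U(3) obtain r l where r: "strict_mono (r :: nat \<Rightarrow> nat)"
    and ul: "uniform_limit K (\<lambda>n. F (r n)) l sequentially"
    unfolding normal_family_on_def using K by metis
  \<comment> \<open>\<open>c\<close> is the height of the circle of radius \<open>s\<close> above
    the south pole \<open>Pt 0\<close> of the unit sphere; it bounds their chordal distance from
    below.\<close>
  define c where "c = (s\<^sup>2 - 1) / (s\<^sup>2 + 1) + 1"
  have "s\<^sup>2 + 1 > 0" by (simp add: add_nonneg_pos)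
  then have "c = 2 * s\<^sup>2 / (s\<^sup>2 + 1)"
    unfolding c_def by (simp add: field_simps)
  then have c: "c > 0" using s by (simp add: add_nonneg_pos)
  have far: "c \<le> dist (Pt w) (Pt 0)" if "cmod w = s" for w
  proof -
    have "dist (snd (stereo (Pt w))) (snd (stereo (Pt 0))) \<le> dist (Pt w) (Pt 0)"
      unfolding dist_riemann_sphere_def by (rule dist_snd_le)
    moreover have "dist (snd (stereo (Pt w))) (snd (stereo (Pt 0))) = \<bar>c\<bar>"
      using that by (simp add: c_def dist_real_def)
    ultimately show ?thesis by linarith
  qed
  have ev: "\<forall>\<^sub>F n in sequentially. \<forall>x\<in>K. dist (F (r n) x) (l x) < c / 4"
    using ul c unfolding uniform_limit_iff by (meson zero_less_divide_iff zero_less_numeral)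
  then obtain n where n: "\<And>x. x \<in> K \<Longrightarrow> dist (F (r n) x) (l x) < c / 4"
    by (auto simp: eventually_sequentially)
  have "continuous_on UNIV (Pt \<circ> poly (f (r n)))"
    by (intro continuous_on_compose continuous_on_Pt continuous_intros)
  then obtain \<delta> where \<delta>: "\<delta> > 0"
    "\<And>y. dist y z < \<delta> \<Longrightarrow> dist (Pt (poly (f (r n)) y)) (Pt (poly (f (r n)) z)) < c / 4"
    unfolding continuous_on_iff using c
    by (metis UNIV_I comp_apply zero_less_divide_iff zero_less_numeral)
  obtain y where y: "(\<lambda>n. poly (f n) y) \<longlonglongrightarrow> 0" "dist y z < min \<delta> \<epsilon>"
    using z \<delta>(1) \<epsilon>(1) unfolding closure_approachable
    by (metis (mono_tags, lifting) mem_Collect_eq min_less_iff_conj)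
  have yK: "Pt y \<in> K" using y(2) by (auto simp: K_def dist_commute)
  have "isCont Pt 0" using continuous_on_Pt[of UNIV] by (simp add: continuous_on_eq_continuous_at)
  then have "(\<lambda>n. Pt (poly (f n) y)) \<longlonglongrightarrow> Pt 0" using y(1) by (rule isCont_tendsto_compose)
  then have "(\<lambda>n. Pt (poly (f (r n)) y)) \<longlonglongrightarrow> Pt 0"
    using LIMSEQ_subseq_LIMSEQ[OF _ r] by (fastforce simp: comp_def)
  then have "\<forall>\<^sub>F m in sequentially. dist (F (r m) (Pt y)) (Pt 0) < c / 4"
    using c unfolding tendsto_iff F_def sphere_map.simps
    by (meson zero_less_divide_iff zero_less_numeral)
  then have "\<forall>\<^sub>F m in sequentially. dist (F (r m) (Pt y)) (Pt 0) < c / 4 \<and>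
      dist (F (r m) (Pt y)) (l (Pt y)) < c / 4"
    using ev by eventually_elim (use yK in auto)
  then obtain m where m: "dist (F (r m) (Pt y)) (Pt 0) < c / 4"
      "dist (F (r m) (Pt y)) (l (Pt y)) < c / 4"
    by (auto simp: eventually_sequentially)
  \<comment> \<open>Four legs shorter than \<open>c / 4\<close>: \<open>F (r n)\<close> from
    \<open>z\<close> to \<open>y\<close>, then to the limit at \<open>y\<close>, to
    \<open>F (r m)\<close> at \<open>y\<close>, to \<open>Pt 0\<close>. The index \<open>m\<close>
    comes last since it depends on \<open>y\<close>.\<close>
  have "dist (F (r n) (Pt z)) (Pt 0) < c"
    using m n[OF yK] \<delta>(2)[of y] y(2)
      dist_triangle[of "F (r n) (Pt z)" "Pt 0" "F (r n) (Pt y)"]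
      dist_triangle[of "F (r n) (Pt y)" "Pt 0" "l (Pt y)"]
      dist_triangle3[of "l (Pt y)" "Pt 0" "F (r m) (Pt y)"]
      dist_commute[of "F (r n) (Pt y)"]
    by (simp add: F_def)
  with far[OF s(2)] show False by (simp add: F_def leD)
qed

lemma components_Pt_image: "components (Pt ` S) = (`) Pt ` components S"
proof -
  have P: "Pt ` C \<in> components (Pt ` S)" if C: "C \<in> components S" for C
    unfolding in_components_maximal
  proof (intro conjI allI impI)
    show "Pt ` C \<noteq> {}" "Pt ` C \<subseteq> Pt ` S" "connected (Pt ` C)"
      using in_components_nonempty[OF C] in_components_subset[OF C] in_components_connected[OF C]
      by (auto intro!: connected_continuous_image continuous_on_Pt)
    fix D assume D: "D \<noteq> {} \<and> Pt ` C \<subseteq> D \<and> D \<subseteq> Pt ` S \<and> connected D"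
    then have "connected (plane_coord ` D)"
      by (intro connected_continuous_image continuous_on_subset[OF continuous_on_plane_coord]) auto
    moreover have "C \<subseteq> plane_coord ` D"
      using D by (force simp: image_iff)
    moreover have "plane_coord ` D \<subseteq> S" using D by auto
    ultimately have "plane_coord ` D = C"
      using components_maximal[OF C] in_components_nonempty[OF C] by (metis inf.absorb1 subset_antisym)
    moreover have "Pt ` plane_coord ` D = id ` D"
      unfolding image_image using D by (intro image_cong) auto
    ultimately show "D = Pt ` C" by simp
  qed
  have "D \<in> (`) Pt ` components S" if D: "D \<in> components (Pt ` S)" for D
  proof -
    obtain z where z: "z \<in> S" "Pt z \<in> D"
      using D in_components_nonempty in_components_subset by blast
    then obtain C where C: "C \<in> components S" "z \<in> C"
      using Union_components by blast
    then have "D = Pt ` C"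
      using components_nonoverlap[OF D P[OF C(1)]] z by blast
    with C show ?thesis by blast
  qed
  with P show ?thesis by blast
qed

section \<open>Level sets and preimages of polynomials\<close>

lemma connected_norm_ivt:
  assumes "connected S" "continuous_on S f" "a \<in> S" "b \<in> S" "norm (f a) \<le> s" "s \<le> norm (f b)"
  shows "\<exists>z\<in>S. norm (f z) = s"
proof -
  have "connected ((\<lambda>z. norm (f z)) ` S)"
    using assms(1,2) by (intro connected_continuous_image continuous_intros)
  then have "{norm (f a)..norm (f b)} \<subseteq> (\<lambda>z. norm (f z)) ` S"
    using assms(3,4) by (intro connected_contains_Icc) auto
  then show ?thesis using assms(5,6) by force
qed

text \<open>Off \<open>X\<close> every map omits the circle of radius \<open>s\<close>, so on a disc
  it stays inside or outside this circle, and it or its reciprocal is bounded. Near infinity,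
  \<open>outer\<close> bounds the reciprocals.\<close>

lemma julia_set_subset:
  assumes X: "closed X" and s: "s > 0"
    and deg: "\<And>g. g \<in> G \<Longrightarrow> degree g > 0"
    and omit: "\<And>g z. g \<in> G \<Longrightarrow> z \<notin> X \<Longrightarrow> cmod (poly g z) \<noteq> s"
    and outer: "\<And>g z. g \<in> G \<Longrightarrow> cmod z > s \<Longrightarrow> cmod (poly g z) > s"
  shows "julia_set G \<subseteq> Pt ` X"
proof -
  have "x \<in> fatou_set G" if x: "x \<notin> Pt ` X" for x
  proof (cases x)
    case (Pt w)
    with x have "w \<in> - X" by auto
    then obtain r where r: "r > 0" "ball w r \<subseteq> - X"
      using X open_contains_ball by (metis open_Compl)
    have "normal_family_on (Pt ` ball w r) (sphere_map ` G)"
    proof (rule normal_family_on_chart[where d = plane_coord and B = "max s (1 / s)"])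
      fix f assume "f \<in> sphere_map ` G"
      then obtain g where g: "g \<in> G" and f: "f = sphere_map g" by auto
      have "(\<forall>z\<in>ball w r. cmod (poly g z) < s) \<or> (\<forall>z\<in>ball w r. cmod (poly g z) > s)"
      proof (rule ccontr)
        assume "\<not> ?thesis"
        then obtain a b where "a \<in> ball w r" "b \<in> ball w r"
            "cmod (poly g a) \<le> s" "s \<le> cmod (poly g b)"
          by (meson linorder_not_less)
        then have "\<exists>z\<in>ball w r. cmod (poly g z) = s"
          by (intro connected_norm_ivt) (auto intro!: continuous_intros)
        then show False using omit[OF g] r(2) by blast
      qed
      then show "\<exists>\<phi>. \<phi> holomorphic_on ball w r \<and> (\<forall>z\<in>ball w r. cmod (\<phi> z) \<le> max s (1 / s)) \<and>
          ((\<forall>z\<in>ball w r. f (Pt z) = Pt (\<phi> z)) \<or>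
           (\<forall>z\<in>ball w r. f (Pt z) = sphere_inv (Pt (\<phi> z))))"
      proof
        assume lt: "\<forall>z\<in>ball w r. cmod (poly g z) < s"
        show ?thesis
        proof (intro exI[of _ "poly g"] conjI disjI1 ballI)
          show "cmod (poly g z) \<le> max s (1 / s)" if "z \<in> ball w r" for z
            using lt that by (meson less_imp_le max.coboundedI1)
        qed (auto simp: f intro!: holomorphic_intros)
      next
        assume gt: "\<forall>z\<in>ball w r. cmod (poly g z) > s"
        then have nz: "poly g z \<noteq> 0" if "z \<in> ball w r" for z
          using s that by (metis norm_zero less_asym)
        have le: "cmod (inverse (poly g z)) \<le> 1 / s" if "z \<in> ball w r" for z
        proof -
          have "s < cmod (poly g z)" using gt that by blast
          then have "inverse (cmod (poly g z)) \<le> inverse s"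
            using s by (intro le_imp_inverse_le) auto
          then show ?thesis by (simp add: norm_inverse norm_divide inverse_eq_divide)
        qed
        show ?thesis
        proof (intro exI[of _ "\<lambda>z. inverse (poly g z)"] conjI disjI2 ballI)
          show "(\<lambda>z. inverse (poly g z)) holomorphic_on ball w r"
            using nz by (intro holomorphic_intros)
          show "cmod (inverse (poly g z)) \<le> max s (1 / s)" if "z \<in> ball w r" for z
            using le[OF that] by simp
          show "f (Pt z) = sphere_inv (Pt (inverse (poly g z)))" if "z \<in> ball w r" for z
            using nz[OF that] f by simp
        qed
      qed
    qed (use continuous_on_plane_coord in auto)
    moreover have "open (Pt ` ball w r)" by (intro open_Pt_image) auto
    moreover have "x \<in> Pt ` ball w r" using Pt r(1) by auto
    ultimately show ?thesis unfolding fatou_set_def by blast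
  next
    case Infty
    let ?e = "\<lambda>z. sphere_inv (Pt z)"
    have "normal_family_on (?e ` ball 0 (1 / s)) (sphere_map ` G)"
    proof (rule normal_family_on_chart[where d = "\<lambda>x. plane_coord (sphere_inv x)" and B = "1 / s"])
      show "continuous_on (range ?e) (\<lambda>x. plane_coord (sphere_inv x))"
        by (rule continuous_on_compose2[OF continuous_on_plane_coord continuous_on_sphere_inv])
           (auto simp del: sphere_inv.simps)
      show "plane_coord (sphere_inv (?e z)) = z" for z
        by (simp del: sphere_inv.simps)
      fix f assume "f \<in> sphere_map ` G"
      then obtain g where g: "g \<in> G" and f: "f = sphere_map g" by auto
      \<comment> \<open>This is \<open>1 / g (1 / w)\<close>, written with the reflected polynomial
        to make it holomorphic at 0, with value 0 there.\<close>
      let ?\<phi> = "\<lambda>w. w ^ degree g / poly (reflect_poly g) w"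
      have big: "cmod (poly g (inverse w)) > s" if "w \<in> ball 0 (1 / s)" "w \<noteq> 0" for w
      proof (rule outer[OF g])
        show "s < cmod (inverse w)"
          using that s by (auto simp: norm_inverse norm_divide field_simps)
      qed
      then have pnz: "poly g (inverse w) \<noteq> 0" if "w \<in> ball 0 (1 / s)" "w \<noteq> 0" for w
        using s that by (metis norm_zero less_asym)
      have nz: "poly (reflect_poly g) w \<noteq> 0" if "w \<in> ball 0 (1 / s)" for w
      proof (cases "w = 0")
        case False
        then show ?thesis using that pnz by (simp add: poly_reflect_poly_nz)
      qed (use deg[OF g] in auto)
      have val: "?\<phi> w = inverse (poly g (inverse w))" if "w \<noteq> 0" for w
        using that by (simp add: poly_reflect_poly_nz field_simps)
      have val0: "?\<phi> 0 = 0" using deg[OF g] by simp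
      have "?\<phi> holomorphic_on ball 0 (1 / s)"
        using nz by (intro holomorphic_intros) auto
      moreover have "cmod (?\<phi> w) \<le> 1 / s" if "w \<in> ball 0 (1 / s)" for w
      proof (cases "w = 0")
        case False
        have "inverse (cmod (poly g (inverse w))) \<le> inverse s"
          using big[OF that False] s by (intro le_imp_inverse_le) auto
        then show ?thesis unfolding val[OF False] by (simp add: norm_inverse norm_divide inverse_eq_divide)
      next
        case True
        then show ?thesis unfolding True val0 using s by simp
      qed
      moreover have "f (?e w) = ?e (?\<phi> w)" if "w \<in> ball 0 (1 / s)" for w
      proof (cases "w = 0")
        case False
        then show ?thesis using pnz[OF that False] unfolding val[OF False] by (simp add: f)
      next
        case True
        then show ?thesis unfolding True val0 using f by simp
      qed
      ultimately show "\<exists>\<phi>. \<phi> holomorphic_on ball 0 (1 / s) \<and> (\<forall>z\<in>ball 0 (1 / s). cmod (\<phi> z) \<le> 1 / s) \<and>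
          ((\<forall>z\<in>ball 0 (1 / s). f (?e z) = Pt (\<phi> z)) \<or>
           (\<forall>z\<in>ball 0 (1 / s). f (?e z) = sphere_inv (Pt (\<phi> z))))"
        by (intro exI[of _ ?\<phi>] conjI disjI2 ballI)
    qed
    moreover have "open (?e ` ball 0 (1 / s))"
      using open_sphere_inv_image[OF open_Pt_image[OF open_ball]] by (simp add: image_image)
    moreover have "x \<in> ?e ` ball 0 (1 / s)"
      using Infty s by (intro image_eqI[of _ _ 0]) auto
    ultimately show ?thesis unfolding fatou_set_def by blast
  qed
  then show ?thesis unfolding julia_set_def by blast
qed

section \<open>Complex polynomials as open and proper maps\<close>

lemma poly_surj:
  fixes p :: "complex poly"
  assumes "degree p > 0"
  obtains z where "poly p z = w"
proof -
  have "degree (p + [:- w:]) > 0"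
    using assms by (simp add: degree_add_eq_left)
  then obtain z where "poly (p + [:- w:]) z = 0"
    using alg_closed_imp_poly_has_root by blast
  then show ?thesis using that[of z] by simp
qed

lemma open_poly_image:
  fixes p :: "complex poly"
  assumes "degree p > 0" "open U"
  shows "open (poly p ` U)"
proof (rule open_mapping_thm[of "poly p" UNIV])
  show "\<not> poly p constant_on UNIV"
  proof
    assume "poly p constant_on UNIV"
    then obtain c where "\<And>z. poly p z = c" unfolding constant_on_def by blast
    moreover obtain z where "poly p z = c + 1" using poly_surj assms(1) by blast
    ultimately show False by (metis add_cancel_right_right zero_neq_one)
  qed
qed (use assms in \<open>auto intro!: holomorphic_intros\<close>)

lemma open_poly_vimage: "open U \<Longrightarrow> open (poly p -` U)" for p :: "complex poly"
  using continuous_on_open_vimage[of UNIV "poly p"] by (auto intro!: continuous_intros)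

lemma closed_poly_vimage: "closed U \<Longrightarrow> closed (poly p -` U)" for p :: "complex poly"
  using continuous_on_closed_vimage[of UNIV "poly p"] by (auto intro!: continuous_intros)

text \<open>The inclusion from right to left holds because a nonconstant polynomial is an open
  map.\<close>

lemma closure_poly_vimage:
  fixes p :: "complex poly"
  assumes "degree p > 0"
  shows "closure (poly p -` X) = poly p -` closure X"
proof
  show "closure (poly p -` X) \<subseteq> poly p -` closure X"
    by (intro closure_minimal closed_poly_vimage vimage_mono closure_subset) auto
  show "poly p -` closure X \<subseteq> closure (poly p -` X)"
  proof
    fix z assume z: "z \<in> poly p -` closure X"
    have "\<exists>y\<in>poly p -` X. y \<in> U" if U: "open U" "z \<in> U" for U
    proof -
      have "open (poly p ` U)" "poly p z \<in> poly p ` U" using U open_poly_image assms by auto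
      then have "X \<inter> poly p ` U \<noteq> {}"
        using z open_Int_closure_eq_empty[of "poly p ` U" X] by blast
      then show ?thesis by blast
    qed
    then show "z \<in> closure (poly p -` X)"
      unfolding closure_iff_nhds_not_empty by (metis disjoint_iff subsetD)
  qed
qed

lemma bounded_poly_vimage:
  fixes p :: "complex poly"
  assumes "degree p > 0" "bounded S"
  shows "bounded (poly p -` S)"
proof -
  obtain a q where p: "p = pCons a q" by (cases p)
  with assms(1) have "q \<noteq> 0" by auto
  obtain B where B: "\<And>x. x \<in> S \<Longrightarrow> cmod x \<le> B" using assms(2) by (auto simp: bounded_iff)
  obtain r where r: "\<And>z. r \<le> cmod z \<Longrightarrow> B + 1 \<le> cmod (poly p z)"
    using poly_infinity[OF \<open>q \<noteq> 0\<close>, of "B + 1" a] p by auto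
  have "cmod z \<le> r" if "poly p z \<in> S" for z
    using r[of z] B[OF that] by linarith
  then show ?thesis by (auto simp: bounded_iff)
qed

text \<open>A nonempty clopen part of the preimage of \<open>K\<close> is mapped onto \<open>K\<close>, so it meets the fibre
  of \<open>w\<close>.\<close>

lemma connected_poly_vimage:
  fixes p :: "complex poly"
  assumes p: "degree p > 0" and K: "open K" "connected K"
    and S: "connected S" "S \<subseteq> poly p -` K" and w: "w \<in> K" "poly p -` {w} \<subseteq> S"
  shows "connected (poly p -` K)"
proof (rule ccontr)
  let ?V = "poly p -` K"
  have V: "open ?V" using K(1) by (rule open_poly_vimage)
  assume "\<not> connected ?V"
  then obtain A B where AB: "open A" "open B" "?V \<subseteq> A \<union> B" "A \<inter> B \<inter> ?V = {}"
      "A \<inter> ?V \<noteq> {}" "B \<inter> ?V \<noteq> {}"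
    unfolding connected_def by blast
  have onto: "poly p ` N = K" if N: "open N" "open (?V - N)" "N \<subseteq> ?V" "N \<noteq> {}" for N
  proof -
    have sub: "poly p ` N \<subseteq> K" using N(3) by auto
    have "openin (top_of_set K) (poly p ` N)"
      using open_poly_image[OF p N(1)] sub by (simp add: open_subset)
    \<comment> \<open>Relative closedness comes from properness: preimages of a convergent sequence
      are bounded and accumulate at some \<open>l\<close>, which stays in \<open>N\<close> because
      \<open>?V - N\<close> is open.\<close>
    moreover have "K \<inter> closure (poly p ` N) = poly p ` N"
    proof
      show "poly p ` N \<subseteq> K \<inter> closure (poly p ` N)" by (rule Int_greatest[OF sub closure_subset])
      show "K \<inter> closure (poly p ` N) \<subseteq> poly p ` N"
      proof
        fix y assume y: "y \<in> K \<inter> closure (poly p ` N)"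
        then have "y \<in> closure (poly p ` N)" by (rule IntD2)
        then obtain x where x: "\<forall>n. x n \<in> poly p ` N" "x \<longlonglongrightarrow> y"
          unfolding closure_sequential by (elim exE conjE)
        have "\<forall>n. \<exists>v. v \<in> N \<and> x n = poly p v" using x(1) unfolding image_iff Bex_def .
        then obtain u where u: "\<And>n. u n \<in> N" "\<And>n. x n = poly p (u n)"
          by metis
        have "bounded (poly p -` range x)"
          using x(2) by (intro bounded_poly_vimage p convergent_imp_bounded)
        then have "bounded (range u)"
          by (rule bounded_subset) (use u(2) in auto)
        then obtain l r where r: "strict_mono (r :: nat \<Rightarrow> nat)" and l: "(u \<circ> r) \<longlonglongrightarrow> l"
          using bounded_imp_convergent_subsequence by blast
        have "isCont (poly p) l" by simp
        then have "(\<lambda>n. poly p ((u \<circ> r) n)) \<longlonglongrightarrow> poly p l"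
          using l by (rule isCont_tendsto_compose)
        moreover have "(x \<circ> r) \<longlonglongrightarrow> y" using x(2) r by (rule LIMSEQ_subseq_LIMSEQ)
        ultimately have pl: "poly p l = y"
          using u(2) LIMSEQ_unique by (simp add: comp_def)
        moreover have "l \<in> N"
        proof (rule ccontr)
          assume "l \<notin> N"
          with pl y have "l \<in> ?V - N" by simp
          then have "\<forall>\<^sub>F n in sequentially. (u \<circ> r) n \<in> ?V - N"
            using l N(2) topological_tendstoD by blast
          then show False using u(1) by (auto simp: eventually_sequentially)
        qed
        ultimately show "y \<in> poly p ` N" by blast
      qed
    qed
    then have "closedin (top_of_set K) (poly p ` N)" by (metis closedin_closed_Int closed_closure)
    ultimately show ?thesis using K(2) N(4) unfolding connected_clopen by blast
  qed
  have meets: "C \<inter> S \<noteq> {}"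
    if C: "open C" "open D" "C \<inter> ?V \<noteq> {}" "?V - C \<inter> ?V = D \<inter> ?V" for C D
  proof -
    have "poly p ` (C \<inter> ?V) = K"
    proof (rule onto)
      show "open (?V - C \<inter> ?V)" unfolding C(4) using C(2) V by blast
    qed (use C V in auto)
    with w(1) obtain a where "a \<in> C" "poly p a = w" by (metis IntD1 imageE)
    with w(2) show ?thesis by auto
  qed
  have "?V - A \<inter> ?V = B \<inter> ?V" "?V - B \<inter> ?V = A \<inter> ?V" using AB(3,4) by auto
  then have "A \<inter> S \<noteq> {}" "B \<inter> S \<noteq> {}"
    using meets AB by metis+
  moreover have "S \<subseteq> A \<union> B" using S(2) AB(3) by (rule subset_trans)
  moreover have "A \<inter> B \<inter> S = {}" using AB(4) S(2) by auto
  ultimately show False using S(1) AB(1,2) unfolding connected_def by metis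
qed

lemma frontier_poly_sublevel:
  fixes p :: "complex poly"
  assumes "degree p > 0" "s > 0"
  shows "frontier {z. cmod (poly p z) < s} = {z. cmod (poly p z) = s}"
proof -
  have V: "{z. cmod (poly p z) < s} = poly p -` ball 0 s" by auto
  have "interior {z. cmod (poly p z) < s} = {z. cmod (poly p z) < s}"
    unfolding V by (intro interior_open open_poly_vimage) auto
  moreover have "closure {z. cmod (poly p z) < s} = poly p -` cball 0 s"
    unfolding V closure_poly_vimage[OF assms(1)] using assms(2) by simp
  ultimately show ?thesis by (auto simp: frontier_def)
qed

text \<open>By the maximum principle \<open>{|p| > s}\<close> has no bounded component; as its
  complement is bounded, it is connected. Its closure is the complement of the connected set
  \<open>{|p| < s}\<close>, and unicoherence makes the common frontier connected.\<close>

lemma connected_poly_level_set: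
  fixes p :: "complex poly"
  assumes p: "degree p > 0" and s: "s > 0" and conn: "connected {z. cmod (poly p z) < s}"
  shows "connected {z. cmod (poly p z) = s}"
proof -
  let ?W = "poly p -` (- cball 0 s)" and ?O = "{z. cmod (poly p z) < s}"
  have opW: "open ?W" by (intro open_poly_vimage) auto
  have unb: "\<not> bounded C" if C: "C \<in> components ?W" for C
  proof
    assume bd: "bounded C"
    obtain \<xi> where \<xi>: "\<xi> \<in> C" "\<xi> \<in> ?W"
      using in_components_nonempty[OF C] in_components_subset[OF C] by blast
    have "frontier C \<subseteq> frontier ?W" using C by (rule frontier_of_components_subset)
    moreover have "frontier ?W \<subseteq> - ?W" unfolding frontier_def interior_open[OF opW] by (simp only: Diff_eq Int_lower2)
    ultimately have fr: "frontier C \<subseteq> - ?W" by (rule subset_trans)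
    have "cmod (poly p \<xi>) \<le> s"
    proof (rule maximum_modulus_frontier[of "poly p" C])
      show "cmod (poly p z) \<le> s" if "z \<in> frontier C" for z
        using subsetD[OF fr that] by simp
    qed (use bd \<xi>(1) in \<open>auto intro!: holomorphic_intros continuous_intros\<close>)
    then show False using \<xi>(2) by simp
  qed
  have bdW: "bounded (- ?W)"
    using bounded_poly_vimage[OF p bounded_cball, of 0 s] by (simp add: vimage_Compl)
  have uniq: "C = C'" if "C \<in> components ?W" "C' \<in> components ?W" for C C'
    using cobounded_unique_unbounded_components[OF bdW] unb that by simp
  have "connected ?W"
  proof (cases "?W = {}")
    case False
    then obtain C where C: "C \<in> components ?W" using components_eq_empty[of ?W] by blast
    then have "components ?W = {C}" using uniq by blast
    then have "?W = C" using Union_components[of ?W] by simp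
    then show ?thesis using in_components_connected[OF C] by simp
  qed (simp only: connected_empty)
  then have "connected (closure ?W)" by (rule connected_imp_connected_closure)
  moreover have "closure ?W = - ?O"
    unfolding closure_poly_vimage[OF p] using s by (auto simp: closure_complement)
  ultimately have "connected (- ?O)" by simp
  moreover obtain z where "poly p z = of_real s" using poly_surj[OF p] by blast
  then have "z \<in> - ?O" using s by simp
  ultimately have "- ?O \<in> components (- ?O)"
    using components_eq_sing_iff[of "- ?O"] by blast
  then have "connected (frontier (- ?O))"
    by (rule connected_frontier_component_complement[OF conn])
  then show ?thesis
    using frontier_poly_sublevel[OF p s] by (simp only: frontier_complement)
qed

section \<open>Superattracting fixed points inside the Julia set\<close>

text \<open>Write \<open>p - a = (z - a)^m q\<close> with \<open>q a \<noteq> 0\<close>. A critical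
  fixed point has \<open>m \<ge> 2\<close>, and \<open>p' (z - a) / (p - a)\<close> tends to
  \<open>m\<close>, so its modulus exceeds \<open>3 / 2\<close> near \<open>a\<close>.\<close>

lemma superattracting_local_bounds:
  fixes p :: "complex poly"
  assumes deg: "degree p > 0" and fixp: "poly p a = a" and crit: "poly (pderiv p) a = 0"
  obtains \<delta> where "\<delta> > 0"
    "\<And>z. z \<noteq> a \<Longrightarrow> dist z a < \<delta> \<Longrightarrow>
       poly p z \<noteq> a \<and> dist (poly p z) a \<le> dist z a \<and>
       3 / 2 * cmod (poly p z - a) \<le> cmod (poly (pderiv p) z) * cmod (z - a)"
proof -
  define P where "P = p - [:a:]"
  define m where "m = order a P"
  have "P \<noteq> 0" using deg by (auto simp: P_def)
  then obtain q where q: "P = [:- a, 1:] ^ m * q" "\<not> [:- a, 1:] dvd q"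
    unfolding m_def using order_decomp by blast
  have qa: "poly q a \<noteq> 0" using q(2) by (simp add: poly_eq_0_iff_dvd)
  have P': "pderiv P = pderiv p" by (simp add: P_def pderiv_diff)
  have pz: "poly p z - a = (z - a) ^ m * poly q z" for z
    using arg_cong[OF q(1), of "\<lambda>r. poly r z"] by (simp add: P_def poly_power algebra_simps)
  have "m \<noteq> 0" using pz[of a] fixp qa by (cases "m = 0") auto
  then obtain k where k: "m = Suc k" by (cases m) auto
  have p': "poly (pderiv p) z = (z - a) ^ k * (of_nat m * poly q z + (z - a) * poly (pderiv q) z)" for z
    unfolding P'[symmetric] q(1) k pderiv_mult pderiv_power_Suc
    by (simp add: pderiv_pCons poly_power algebra_simps del: of_nat_Suc)
  have "k \<noteq> 0" using p'[of a] crit qa k by (cases "k = 0") auto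
  then obtain j where j: "k = Suc j" by (cases k) auto
  have c1: "isCont (poly q) a" and c2: "isCont (\<lambda>z. cmod ((z - a) ^ k * poly q z)) a"
    by (auto intro!: continuous_intros)
  have c3: "isCont (\<lambda>z. cmod (of_nat m + (z - a) * poly (pderiv q) z / poly q z)) a"
    using qa by (auto intro!: continuous_intros)
  have cm: "3 / 2 < cmod (of_nat m)" unfolding norm_of_nat by (simp add: k j)
  have "\<forall>\<^sub>F z in at a. poly q z \<noteq> 0"
    using c1 qa unfolding isCont_def by (rule tendsto_imp_eventually_ne)
  moreover have "\<forall>\<^sub>F z in at a. cmod ((z - a) ^ k * poly q z) < 1"
    using c2 \<open>k \<noteq> 0\<close> unfolding isCont_def by (intro order_tendstoD(2)) (auto simp: zero_power)
  moreover have "\<forall>\<^sub>F z in at a. cmod (of_nat m + (z - a) * poly (pderiv q) z / poly q z) > 3 / 2"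
    using c3 cm unfolding isCont_def by (intro order_tendstoD(1)) simp_all
  ultimately have "\<forall>\<^sub>F z in at a. poly q z \<noteq> 0 \<and> cmod ((z - a) ^ k * poly q z) < 1 \<and>
      cmod (of_nat m + (z - a) * poly (pderiv q) z / poly q z) > 3 / 2"
    by eventually_elim auto
  then obtain \<delta> where \<delta>: "\<delta> > 0" "\<And>z. z \<noteq> a \<Longrightarrow> dist z a < \<delta> \<Longrightarrow>
      poly q z \<noteq> 0 \<and> cmod ((z - a) ^ k * poly q z) < 1 \<and>
      cmod (of_nat m + (z - a) * poly (pderiv q) z / poly q z) > 3 / 2"
    unfolding eventually_at by blast
  show ?thesis
  proof (rule that[OF \<delta>(1)])
    fix z assume z: "z \<noteq> a" "dist z a < \<delta>"
    note b = \<delta>(2)[OF z]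
    have pz': "poly p z - a = (z - a) * ((z - a) ^ k * poly q z)"
      using pz[of z] k by simp
    have ne: "poly p z \<noteq> a" using pz[of z] z(1) b by auto
    have "cmod (z - a) * cmod ((z - a) ^ k * poly q z) \<le> cmod (z - a) * 1"
      using b by (intro mult_left_mono) auto
    then have lt: "dist (poly p z) a \<le> dist z a"
      unfolding dist_norm pz' norm_mult[of "z - a"] by linarith
    have "poly (pderiv p) z * (z - a)
        = (of_nat m + (z - a) * poly (pderiv q) z / poly q z) * (poly p z - a)"
      using b unfolding p' pz' by (simp add: field_simps)
    then have "cmod (poly (pderiv p) z) * cmod (z - a)
        = cmod (of_nat m + (z - a) * poly (pderiv q) z / poly q z) * cmod (poly p z - a)"
      by (metis norm_mult)
    moreover have "3 / 2 * cmod (poly p z - a) \<le>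
        cmod (of_nat m + (z - a) * poly (pderiv q) z / poly q z) * cmod (poly p z - a)"
      using b by (intro mult_right_mono) auto
    ultimately show "poly p z \<noteq> a \<and> dist (poly p z) a \<le> dist z a \<and>
       3 / 2 * cmod (poly p z - a) \<le> cmod (poly (pderiv p) z) * cmod (z - a)"
      using ne lt by simp
  qed
qed

text \<open>Near a superattracting fixed point \<open>a\<close>, the logarithmic derivatives of \<open>p\<^sup>n - a\<close> grow
  geometrically, so by Bloch's theorem the image of any small disc under some iterate contains
  a full circle about \<open>a\<close>, and this circle meets the continuum \<open>K\<close>.\<close>

lemma superattracting_fixed_point_in_interior:
  fixes p :: "complex poly"
  assumes deg: "degree p > 0" and fixp: "poly p a = a" and crit: "poly (pderiv p) a = 0"
    and J: "closed J" "\<And>z. poly p z \<in> J \<Longrightarrow> z \<in> J"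
    and K: "connected K" "K \<subseteq> J" "a \<in> K" "b \<in> K" "b \<noteq> a"
  shows "a \<in> interior J"
proof -
  obtain \<delta>0 where \<delta>0: "\<delta>0 > 0" and step0:
    "\<And>z. z \<noteq> a \<Longrightarrow> dist z a < \<delta>0 \<Longrightarrow>
       poly p z \<noteq> a \<and> dist (poly p z) a \<le> dist z a \<and>
       3 / 2 * cmod (poly p z - a) \<le> cmod (poly (pderiv p) z) * cmod (z - a)"
    using superattracting_local_bounds[OF deg fixp crit] by metis
  define f where "f n = poly p ^^ n" for n
  have f0: "f 0 z = z" and fS: "f (Suc n) z = poly p (f n z)" for n z
    by (simp_all add: f_def)
  have hol: "f n holomorphic_on UNIV" for n
  proof (induction n)
    case (Suc n)
    then have "poly p \<circ> f n holomorphic_on UNIV"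
      by (intro holomorphic_on_compose) (auto intro!: holomorphic_intros)
    then show ?case by (simp add: f_def comp_def)
  qed (simp add: f_def id_def)
  have fJ: "z \<in> J" if "f n z \<in> J" for n z
    using that
  proof (induction n)
    case (Suc n)
    then show ?case using J(2) fS by metis
  qed (simp add: f0)
  have stay: "f n z \<noteq> a \<and> dist (f n z) a < e" if "z \<noteq> a" "dist z a < e" "e \<le> \<delta>0" for n z e
    using that(1,2)
  proof (induction n)
    case (Suc n)
    then show ?case using step0[of "f n z"] that(3) by (simp add: fS)
  qed (simp add: f0)
  \<comment> \<open>By the chain rule, the logarithmic derivative of \<open>f n - a\<close>,
    multiplied by \<open>z - a\<close>, gains a factor of at least \<open>3 / 2\<close> in modulus
    with each iteration.\<close>
  have grow: "\<exists>D. (f n has_field_derivative D) (at z) \<and>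
      (3 / 2) ^ n * cmod (f n z - a) \<le> cmod D * cmod (z - a)" if z: "z \<noteq> a" "dist z a < \<delta>0" for n z
  proof (induction n)
    case 0
    have "(f 0 has_field_derivative 1) (at z)" by (simp add: f_def id_def)
    then show ?case using f0 by (intro exI[of _ 1]) simp
  next
    case (Suc n)
    then obtain D where D: "(f n has_field_derivative D) (at z)"
        "(3 / 2) ^ n * cmod (f n z - a) \<le> cmod D * cmod (z - a)" by blast
    let ?y = "f n z" and ?E = "poly (pderiv p) (f n z)"
    have y: "3 / 2 * cmod (poly p ?y - a) \<le> cmod ?E * cmod (?y - a)"
      using step0 stay[OF z order_refl] by blast
    have "((\<lambda>z. poly p (f n z)) has_field_derivative ?E * D) (at z)"
      by (rule DERIV_chain2[OF poly_DERIV D(1)])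
    then have "(f (Suc n) has_field_derivative ?E * D) (at z)"
      by (simp add: fS[abs_def])
    moreover have "(3 / 2) ^ Suc n * cmod (f (Suc n) z - a) \<le> cmod (?E * D) * cmod (z - a)"
    proof -
      have "(3 / 2) ^ Suc n * cmod (f (Suc n) z - a) = (3 / 2) ^ n * (3 / 2 * cmod (poly p ?y - a))"
        by (simp add: fS)
      also have "\<dots> \<le> (3 / 2) ^ n * (cmod ?E * cmod (?y - a))"
        using y by (intro mult_left_mono) auto
      also have "\<dots> = cmod ?E * ((3 / 2) ^ n * cmod (?y - a))" by (simp add: mult_ac)
      also have "\<dots> \<le> cmod ?E * (cmod D * cmod (z - a))"
        using D(2) by (intro mult_left_mono) auto
      finally show ?thesis by (simp add: norm_mult mult_ac)
    qed
    ultimately show ?case by blast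
  qed
  \<comment> \<open>The bound \<open>cmod (b - a)\<close> makes every circle about \<open>a\<close>
    of radius below \<open>\<delta>\<close> separate \<open>a\<close> from \<open>b\<close>, hence
    meet \<open>K\<close>.\<close>
  define \<delta> where "\<delta> = min \<delta>0 (cmod (b - a))"
  have \<delta>: "\<delta> > 0" "\<delta> \<le> \<delta>0" "\<delta> \<le> cmod (b - a)" using \<delta>0 K(5) by (auto simp: \<delta>_def)
  have aJ: "a \<in> J" using K by blast
  have "z \<in> J" if z: "z \<in> ball a \<delta>" for z
  proof (rule ccontr)
    assume "z \<notin> J"
    then have "z \<in> ball a \<delta> - J" using z by simp
    moreover have "open (ball a \<delta> - J)" using J(1) by (intro open_Diff) auto
    ultimately obtain \<eta> where \<eta>: "\<eta> > 0" "ball z \<eta> \<subseteq> ball a \<delta> - J"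
      using open_contains_ball by metis
    have near: "u \<noteq> a" "dist u a < \<delta>" "dist u a < \<delta>0" if "u \<in> ball z \<eta>" for u
    proof -
      have u: "u \<in> ball a \<delta> - J" using \<eta>(2) that by blast
      then show "u \<noteq> a" using aJ by blast
      show "dist u a < \<delta>" using u by (simp add: dist_commute)
      then show "dist u a < \<delta>0" using \<delta>(2) by simp
    qed
    have zb: "z \<in> ball z \<eta>" using \<eta>(1) by simp
    have za: "z \<noteq> a" "dist z a < \<delta>0" using near zb by auto
    have "cmod (z - a) > 0" using za by simp
    \<comment> \<open>\<open>48 = 4 * 12\<close>: Bloch's theorem costs a factor 12, and the image
      disc should have radius 4, which is more than \<open>pi\<close>.\<close>
    obtain n where n: "48 * cmod (z - a) / \<eta> < (3 / 2) ^ n"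
      using real_arch_pow[of "3 / 2"] by auto
    have "(\<lambda>u. f n u - a) holomorphic_on ball z \<eta>"
      by (intro holomorphic_intros holomorphic_on_subset[OF hol]) auto
    moreover have "f n u - a \<noteq> 0" if "u \<in> ball z \<eta>" for u
      using stay[OF near(1,3)[OF that] order_refl] by simp
    \<comment> \<open>\<open>f n\<close> avoids \<open>a\<close> on the disc, so
      \<open>f n - a\<close> has a holomorphic logarithm; the derivative of \<open>L\<close> at
      \<open>z\<close> is the quantity bounded below by \<open>grow\<close>.\<close>
    ultimately obtain L where L: "L holomorphic_on ball z \<eta>" "\<And>u. u \<in> ball z \<eta> \<Longrightarrow> exp (L u) = f n u - a"
      using holomorphic_logarithm_exists[of "ball z \<eta>" "\<lambda>u. f n u - a" z] zb
      by (metis convex_ball open_ball)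
    obtain D where D: "(f n has_field_derivative D) (at z)"
      "(3 / 2) ^ n * cmod (f n z - a) \<le> cmod D * cmod (z - a)" using grow[OF za] by blast
    have "(L has_field_derivative deriv L z) (at z)"
      using L(1) zb by (intro holomorphic_derivI[of L "ball z \<eta>"]) auto
    then have "((\<lambda>u. exp (L u)) has_field_derivative exp (L z) * deriv L z) (at z)"
      by (auto intro!: derivative_eq_intros)
    moreover have "((\<lambda>u. exp (L u)) has_field_derivative D) (at z)"
    proof (rule DERIV_cong_ev[THEN iffD2])
      show "\<forall>\<^sub>F u in nhds z. exp (L u) = f n u - a"
        using L(2) \<eta>(1) by (intro eventually_nhds_in_open[THEN eventually_mono, of "ball z \<eta>"]) auto
      show "((\<lambda>u. f n u - a) has_field_derivative D) (at z)"
        using D(1) by (auto intro!: derivative_eq_intros)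
    qed simp_all
    ultimately have "D = (f n z - a) * deriv L z"
      using DERIV_unique L(2)[OF zb] by metis
    then have "cmod (f n z - a) * (3 / 2) ^ n \<le> cmod (f n z - a) * (cmod (deriv L z) * cmod (z - a))"
      using D(2) by (simp add: norm_mult mult_ac)
    moreover have "cmod (f n z - a) > 0" using stay[OF za order_refl] by simp
    ultimately have "(3 / 2) ^ n \<le> cmod (deriv L z) * cmod (z - a)" by (simp only: mult_le_cancel_left_pos)
    with n have "48 * cmod (z - a) / \<eta> \<le> cmod (deriv L z) * cmod (z - a)" by linarith
    then have "4 \<le> \<eta> * cmod (deriv L z) / 12"
      using \<open>cmod (z - a) > 0\<close> \<eta>(1) by (simp add: field_simps)
    then obtain c where c: "ball c 4 \<subseteq> L ` ball z \<eta>"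
      using Bloch[OF L(1) \<eta>(1)] by blast
    obtain v where v: "v \<in> ball z \<eta>" "c = L v"
      using c by (metis centre_in_ball imageE subsetD zero_less_numeral)
    have "cmod (exp c) < \<delta>"
    proof -
      have "dist (f n v) a < \<delta>" 
        using stay[of v \<delta>] near[OF v(1)] \<delta>(2) by blast
      then show ?thesis using L(2)[OF v(1)] v(2) by (simp add: dist_norm)
    qed
    then have "\<exists>k\<in>K. cmod (k - a) = cmod (exp c)"
      using K \<delta>(3) by (intro connected_norm_ivt[of K "\<lambda>k. k - a" a b])
        (auto intro!: continuous_intros)
    then obtain k where k: "k \<in> K" "cmod (k - a) = cmod (exp c)" by blast
    \<comment> \<open>Adding \<open>\<theta>\<close> to the logarithm turns \<open>exp c\<close>
      into \<open>k - a\<close>. Both have the same modulus, so \<open>\<theta>\<close> is purely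
      imaginary, of size at most \<open>pi < 4\<close>.\<close>
    define \<theta> where "\<theta> = Ln ((k - a) / exp c)"
    have u1: "cmod ((k - a) / exp c) = 1" using k(2) by (simp add: norm_divide)
    then have nz: "(k - a) / exp c \<noteq> 0" by (metis norm_zero zero_neq_one)
    have "Re \<theta> = 0" using u1 nz by (simp add: \<theta>_def)
    then have "cmod \<theta> = \<bar>Im \<theta>\<bar>" by (simp add: cmod_def)
    also have "\<dots> \<le> pi"
      using mpi_less_Im_Ln[OF nz] Im_Ln_le_pi[OF nz] by (simp add: \<theta>_def abs_le_iff)
    finally have "cmod \<theta> < 4" using pi_less_4 by linarith
    then have "c + \<theta> \<in> ball c 4" by (simp add: dist_norm)
    then obtain u where u: "u \<in> ball z \<eta>" "L u = c + \<theta>" using c by (metis imageE subsetD)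
    have "exp \<theta> = (k - a) / exp c" unfolding \<theta>_def using nz by (rule exp_Ln)
    then have "exp (c + \<theta>) = k - a" by (simp add: exp_add)
    \<comment> \<open>An iterate sends a point of the disc into \<open>K\<close>; backward
      invariance puts this point in \<open>J\<close>, against the choice of the disc.\<close>
    then have "f n u = k" using L(2)[OF u(1)] u(2) by simp
    then have "u \<in> J" using fJ[of n u] k(1) K(2) by blast
    then show False using u(1) \<eta>(2) by blast
  qed
  then show ?thesis using \<delta>(1) by (meson mem_interior subsetI)
qed

section \<open>The generators\<close>

definition poly_iter :: "complex poly \<Rightarrow> nat \<Rightarrow> complex poly" where
  "poly_iter h n = ((\<lambda>q. h \<circ>\<^sub>p q) ^^ n) [:0, 1:]"

lemma poly_iter_simps [simp]: "poly_iter h 0 = [:0, 1:]" "poly_iter h (Suc n) = h \<circ>\<^sub>p poly_iter h n"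
  by (simp_all add: poly_iter_def)

lemma pcompose_idL: "[:0, 1:] \<circ>\<^sub>p p = p" for p :: "complex poly"
  by (simp add: pcompose_pCons)

lemma poly_iter_in_semigroup: "h \<in> H \<Longrightarrow> poly_iter h (Suc n) \<in> semigroup_generated H"
  by (induction n) (simp_all add: semigroup_generated.generator semigroup_generated.compose)

text \<open>In the variable \<open>r = |z| / s\<close> such a map acts as
  \<open>r \<mapsto> r^d\<close>. This covers \<open>gen2\<close> with \<open>s = 1\<close> and
  \<open>gen3\<close> with \<open>s = 4\<close>.\<close>

lemma norm_poly_iter_monomial:
  assumes h: "\<And>z. cmod (poly h z) = s * (cmod z / s) ^ d" and s: "s > 0"
  shows "cmod (poly (poly_iter h n) z) = s * (cmod z / s) ^ (d ^ n)"
proof (induction n)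
  case (Suc n)
  have "cmod (poly (poly_iter h (Suc n)) z) = s * ((cmod z / s) ^ d ^ n) ^ d"
    using s by (simp add: poly_pcompose h Suc.IH)
  then show ?case by (simp add: mult.commute flip: power_mult)
qed (use s in simp)

text \<open>After \<open>g\<close>, the iterates of \<open>h\<close> keep modulus \<open>s\<close>
  where \<open>|g| = s\<close> and tend to 0 where \<open>|g| < s\<close>. The former set lies in
  the closure of the latter, so \<open>julia_set_memI\<close> applies.\<close>

lemma monomial_circle_subset_julia_set:
  assumes h: "\<And>z. cmod (poly h z) = s * (cmod z / s) ^ d" and s: "s > 0" and d: "d \<ge> 2"
    and g: "degree g > 0" "cmod (poly g z) = s" and G: "\<And>n. poly_iter h (Suc n) \<circ>\<^sub>p g \<in> G"
  shows "Pt z \<in> julia_set G"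
proof (rule julia_set_memI[OF G s])
  show "cmod (poly (poly_iter h (Suc n) \<circ>\<^sub>p g) z) = s" for n
    unfolding poly_pcompose norm_poly_iter_monomial[OF h s] using g s by simp
  have lim: "(\<lambda>n. poly (poly_iter h (Suc n) \<circ>\<^sub>p g) y) \<longlonglongrightarrow> 0" if y: "cmod (poly g y) < s" for y
  proof -
    let ?x = "cmod (poly g y) / s"
    have x: "0 \<le> ?x" "?x < 1" using y s by auto
    have "(\<lambda>n. s * ?x ^ n) \<longlonglongrightarrow> s * 0"
      using x by (intro tendsto_intros LIMSEQ_realpow_zero)
    then have null: "(\<lambda>n. s * ?x ^ n) \<longlonglongrightarrow> 0" by simp
    have "cmod (poly (poly_iter h (Suc n) \<circ>\<^sub>p g) y) \<le> s * ?x ^ n" for n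
    proof -
      have "n \<le> d ^ n" using d by (simp add: less_imp_le)
      also have "\<dots> \<le> d ^ Suc n" using d by (intro power_increasing) auto
      finally have "?x ^ d ^ Suc n \<le> ?x ^ n" using x by (intro power_decreasing) auto
      then show ?thesis
        unfolding poly_pcompose norm_poly_iter_monomial[OF h s] using s by simp
    qed
    then show ?thesis
      by (intro Lim_null_comparison[OF always_eventually null] allI)
  qed
  have "z \<in> poly g -` closure (ball 0 s)" using g s by simp
  also have "\<dots> = closure (poly g -` ball 0 s)" by (rule closure_poly_vimage[OF g(1), symmetric])
  also have "\<dots> \<subseteq> closure {y. (\<lambda>n. poly (poly_iter h (Suc n) \<circ>\<^sub>p g) y) \<longlonglongrightarrow> 0}"
    using lim by (intro closure_mono) auto
  finally show "z \<in> closure {y. (\<lambda>n. poly (poly_iter h (Suc n) \<circ>\<^sub>p g) y) \<longlonglongrightarrow> 0}" .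
qed

lemma closed_julia_set: "closed (julia_set G)"
proof -
  have "open (fatou_set G)" unfolding fatou_set_def open_subopen[of "{z. _ z}"] by blast
  then show ?thesis by (simp add: julia_set_def closed_def Compl_eq_Diff_UNIV[symmetric])
qed

text \<open>\<open>gen1\<close> has the finite critical points 0 and 1, both fixed. The exponent 32
  gives \<open>(19/20)^32 < 1/4\<close>. The factor \<open>1/256 = 4^(-4)\<close> makes
  \<open>|z| = 4\<close> invariant under \<open>gen3\<close>, whose exponent 5 sends
  \<open>|z| \<le> 2\<close> to \<open>|z| \<le> 1/8\<close>.\<close>

definition gen1 :: "complex poly" where "gen1 = [:0, 0, 3, - 2:]"
definition gen2 :: "complex poly" where "gen2 = monom 1 32"
definition gen3 :: "complex poly" where "gen3 = monom (1 / 256) 5"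

lemma poly_gen1: "poly gen1 z = z\<^sup>2 * (3 - 2 * z)"
  by (simp add: gen1_def power2_eq_square algebra_simps)

lemma poly_gen2: "poly gen2 z = z ^ 32"
  by (simp add: gen2_def poly_monom)

lemma poly_gen3: "poly gen3 z = z ^ 5 / 256"
  by (simp add: gen3_def poly_monom)

lemma norm_gen2: "cmod (poly gen2 z) = cmod z ^ 32"
  by (simp add: poly_gen2 norm_power)

lemma norm_gen2_monomial: "cmod (poly gen2 z) = 1 * (cmod z / 1) ^ 32"
  by (simp add: norm_gen2)

lemma norm_gen3: "cmod (poly gen3 z) = cmod z ^ 5 / 256"
  by (simp add: poly_gen3 norm_power norm_divide)

lemma norm_gen3_monomial: "cmod (poly gen3 z) = 4 * (cmod z / 4) ^ 5"
  by (simp add: norm_gen3 power_divide)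

lemma norm_gen1_le: "cmod (poly gen1 z) \<le> (cmod z)\<^sup>2 * (3 + 2 * cmod z)"
  using norm_triangle_ineq4[of 3 "2 * z"]
  by (simp add: poly_gen1 norm_mult norm_power mult_left_mono)

lemma norm_gen1_ge: "(cmod z)\<^sup>2 * (2 * cmod z - 3) \<le> cmod (poly gen1 z)"
  using norm_triangle_ineq2[of "2 * z" 3]
  by (simp add: poly_gen1 norm_mult norm_power mult_left_mono norm_minus_commute)

lemma degree_gen: "degree gen1 = 3" "degree gen2 = 32" "degree gen3 = 5"
  by (simp_all add: gen1_def gen2_def gen3_def degree_monom_eq)

section \<open>The monoid of words in the generators\<close>

definition gens :: "complex poly set" where "gens = {gen1, gen2, gen3}"

text \<open>The identity is adjoined so that the circle \<open>|z| = 4\<close> is the level set of a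
  word, the empty one.\<close>

definition gen_monoid :: "complex poly set" where
  "gen_monoid = insert [:0, 1:] (semigroup_generated gens)"

lemma gen_monoid_induct [consumes 1, case_names id gen1 gen2 gen3 comp]:
  assumes "g \<in> gen_monoid" "P (\<lambda>z. z)" "P (poly gen1)" "P (poly gen2)" "P (poly gen3)"
    "\<And>f g. P f \<Longrightarrow> P g \<Longrightarrow> P (\<lambda>z. f (g z))"
  shows "P (poly g)"
proof -
  have "P (poly g)" if "g \<in> semigroup_generated gens"
    using that
  proof induction
    case (generator h)
    then show ?case using assms unfolding gens_def by auto
  next
    case (compose f g)
    then show ?case using assms(6) by (simp add: poly_pcompose[abs_def] comp_def)
  qed
  moreover have "poly [:0, 1:] = (\<lambda>z::complex. z)" by auto
  ultimately show ?thesis using assms(1,2) unfolding gen_monoid_def by auto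
qed

lemma gens_subset_monoid: "gen1 \<in> gen_monoid" "gen2 \<in> gen_monoid" "gen3 \<in> gen_monoid" "[:0, 1:] \<in> gen_monoid"
  unfolding gen_monoid_def gens_def by (auto intro: semigroup_generated.generator)

lemma semigroup_compose_monoid:
  "f \<in> semigroup_generated gens \<Longrightarrow> g \<in> gen_monoid \<Longrightarrow> f \<circ>\<^sub>p g \<in> semigroup_generated gens"
  unfolding gen_monoid_def by (auto intro: semigroup_generated.compose)

lemma gen_monoid_compose: "f \<in> gen_monoid \<Longrightarrow> g \<in> gen_monoid \<Longrightarrow> f \<circ>\<^sub>p g \<in> gen_monoid"
  using semigroup_compose_monoid unfolding gen_monoid_def by (auto simp: pcompose_idL)

lemma poly_iter_in_monoid: "h \<in> gen_monoid \<Longrightarrow> poly_iter h n \<in> gen_monoid"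
  by (induction n) (simp_all add: gens_subset_monoid gen_monoid_compose)

text \<open>Splits off the generator that is applied first; it decides in which preimage the level
  set of \<open>g\<close> lies.\<close>

lemma gen_monoid_cases:
  assumes "g \<in> gen_monoid"
  obtains "g = [:0, 1:]" | f h where "f \<in> gen_monoid" "h \<in> gens" "g = f \<circ>\<^sub>p h"
proof -
  have "\<exists>f\<in>gen_monoid. \<exists>h\<in>gens. g = f \<circ>\<^sub>p h" if "g \<in> semigroup_generated gens"
    using that
  proof induction
    case (generator h)
    then show ?case using gens_subset_monoid(4) pcompose_idL by metis
  next
    case (compose f g)
    then obtain f' h where *: "f' \<in> gen_monoid" "h \<in> gens" "g = f' \<circ>\<^sub>p h" by blast
    then have "f \<circ>\<^sub>p f' \<in> gen_monoid"
      using compose(1) by (intro gen_monoid_compose) (auto simp: gen_monoid_def)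
    then show ?case using * pcompose_assoc by metis
  qed
  with assms that show ?thesis unfolding gen_monoid_def by blast
qed

lemma semigroup_degree: "g \<in> semigroup_generated gens \<Longrightarrow> degree g \<ge> 2"
proof (induction rule: semigroup_generated.induct)
  case (compose f g)
  then have "2 * 1 \<le> degree f * degree g" by (intro mult_le_mono) auto
  then show ?case by (simp add: degree_pcompose)
qed (auto simp: gens_def degree_gen)

lemma gen_monoid_degree: "g \<in> gen_monoid \<Longrightarrow> degree g > 0"
  using semigroup_degree by (force simp: gen_monoid_def)

lemma gen_monoid_norm_ge: "g \<in> gen_monoid \<Longrightarrow> 4 \<le> cmod z \<Longrightarrow> cmod z \<le> cmod (poly g z)"
proof (induction arbitrary: z rule: gen_monoid_induct)
  case gen1
  have "cmod z * 1 \<le> cmod z * (cmod z * (2 * cmod z - 3))"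
    using gen1 mult_mono[of 1 "cmod z" 1 "2 * cmod z - 3"] by (intro mult_left_mono) auto
  then show ?case using norm_gen1_ge[of z] by (simp add: power2_eq_square mult_ac)
next
  case gen2
  then show ?case unfolding norm_gen2 by (intro self_le_power) auto
next
  case gen3
  have "cmod z * 4 ^ 4 \<le> cmod z * cmod z ^ 4" using gen3 by (intro mult_left_mono power_mono) auto
  then show ?case by (simp add: norm_gen3 eval_nat_numeral)
next
  case (comp f g)
  then show ?case by (meson order_trans)
qed simp

lemma gen_monoid_norm_gt: "g \<in> gen_monoid \<Longrightarrow> 4 < cmod z \<Longrightarrow> 4 < cmod (poly g z)"
  using gen_monoid_norm_ge[of g z] by simp

text \<open>A forward invariant disc about the common fixed point 0, which level sets at height 4
  therefore avoid. For \<open>gen1\<close> it rests on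
  \<open>|z| (3 + 2 |z|) \<le> 1\<close>.\<close>

lemma gen_monoid_norm_less: "g \<in> gen_monoid \<Longrightarrow> cmod z < 1 / 4 \<Longrightarrow> cmod (poly g z) < 1 / 4"
proof (induction arbitrary: z rule: gen_monoid_induct)
  case gen1
  have "cmod z * (3 + 2 * cmod z) \<le> 1 / 4 * 4" using gen1 by (intro mult_mono) auto
  then have "cmod z * (cmod z * (3 + 2 * cmod z)) \<le> cmod z * 1" by (intro mult_left_mono) auto
  then show ?case using norm_gen1_le[of z] gen1 by (simp add: power2_eq_square mult_ac)
next
  case gen2
  then have "cmod z ^ 32 \<le> cmod z ^ 1" by (intro power_decreasing) auto
  with gen2 show ?case by (simp add: norm_gen2)
next
  case gen3
  then have "cmod z ^ 5 \<le> cmod z ^ 1" by (intro power_decreasing) auto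
  with gen3 show ?case by (simp add: norm_gen3)
qed auto

section \<open>The invariant segment and connected preimages\<close>

definition unit_segment :: "complex set" where "unit_segment = of_real ` {0..1}"

text \<open>The upper bound is \<open>(1 - x)^2 (1 + 2 x) \<ge> 0\<close>. The range extends to
  \<open>3 / 2\<close> because this is the other zero of \<open>gen1\<close>, to be joined to
  0.\<close>

lemma gen1_unit_segment:
  assumes "0 \<le> x" "x \<le> 3 / 2"
  shows "poly gen1 (of_real x) \<in> unit_segment"
proof -
  have "poly gen1 (of_real x) = of_real (x\<^sup>2 * (3 - 2 * x))" by (simp add: poly_gen1)
  moreover have "1 - x\<^sup>2 * (3 - 2 * x) = (1 - x)\<^sup>2 * (1 + 2 * x)"
    by (simp add: power2_eq_square algebra_simps)
  then have "x\<^sup>2 * (3 - 2 * x) \<le> 1"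
    using assms by (metis diff_ge_0_iff_ge add_nonneg_nonneg mult_nonneg_nonneg zero_le_numeral zero_le_one zero_le_power2)
  moreover have "0 \<le> x\<^sup>2 * (3 - 2 * x)" using assms by simp
  ultimately show ?thesis
    unfolding unit_segment_def by (intro image_eqI[of _ _ "x\<^sup>2 * (3 - 2 * x)"]) auto
qed

lemma gen_monoid_unit_segment: "g \<in> gen_monoid \<Longrightarrow> z \<in> unit_segment \<Longrightarrow> poly g z \<in> unit_segment"
proof (induction arbitrary: z rule: gen_monoid_induct)
  case gen1
  then show ?case using gen1_unit_segment by (auto simp: unit_segment_def)
next
  case gen2
  then show ?case by (auto simp: unit_segment_def poly_gen2 power_le_one simp flip: of_real_power)
next
  case gen3
  then obtain x where "z = of_real x" "0 \<le> x" "x \<le> 1" by (auto simp: unit_segment_def)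
  moreover have "x ^ 5 \<le> 1" using calculation by (intro power_le_one)
  ultimately show ?case unfolding unit_segment_def poly_gen3
    by (intro image_eqI[of _ _ "x ^ 5 / 256"]) auto
qed auto

lemma zero_in_unit_segment: "0 \<in> unit_segment"
  unfolding unit_segment_def by (intro image_eqI[of _ _ 0]) auto

lemma norm_unit_segment: "z \<in> unit_segment \<Longrightarrow> cmod z \<le> 1"
  by (auto simp: unit_segment_def)

text \<open>Open connected supersets of the segment are stable under preimages by each generator:
  the segment is forward invariant, and the fibre over 0 can be joined inside the preimage. The
  induction therefore carries all three properties.\<close>

lemma gen_monoid_connected_vimage:
  assumes "g \<in> gen_monoid"
  shows "\<And>K. open K \<Longrightarrow> connected K \<Longrightarrow> unit_segment \<subseteq> K \<Longrightarrow> connected (poly g -` K)"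
proof -
  have "\<forall>K. open K \<longrightarrow> connected K \<longrightarrow> unit_segment \<subseteq> K \<longrightarrow>
      open (poly g -` K) \<and> connected (poly g -` K) \<and> unit_segment \<subseteq> poly g -` K"
    using assms
  proof (induction rule: gen_monoid_induct)
    case gen1
    have "connected (poly gen1 -` K)" if K: "open K" "connected K" "unit_segment \<subseteq> K" for K
    proof (rule connected_poly_vimage[OF _ K(1,2)])
      \<comment> \<open>The fibre of \<open>gen1\<close> over 0 is \<open>{0, 3/2}\<close>; for the
        two monomials it will be the single point 0.\<close>
      show "connected (complex_of_real ` {0..3/2})"
        by (intro connected_continuous_image continuous_intros) auto
      show "complex_of_real ` {0..3/2} \<subseteq> poly gen1 -` K"
      proof
        fix z :: complex assume "z \<in> complex_of_real ` {0..3/2}"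
        then have "poly gen1 z \<in> unit_segment" by (elim imageE) (simp add: gen1_unit_segment)
        then show "z \<in> poly gen1 -` K" using K(3) by blast
      qed
      show "0 \<in> K" using K(3) zero_in_unit_segment by blast
      have "z \<in> complex_of_real ` {0..3/2}" if "poly gen1 z = 0" for z
      proof -
        from that have "z = 0 \<or> 3 - 2 * z = 0" by (simp add: poly_gen1)
        moreover have "z = 3 / 2" if "3 - 2 * z = 0"
        proof -
          have "z = 2 * z / 2" by simp
          also have "2 * z = 3" using that by (metis right_minus_eq)
          finally show ?thesis .
        qed
        ultimately have "z = of_real 0 \<or> z = of_real (3/2)" by auto
        then show ?thesis by (metis atLeastAtMost_iff imageI order_refl zero_le_divide_iff zero_le_numeral)
      qed
      then show "poly gen1 -` {0} \<subseteq> complex_of_real ` {0..3/2}" by auto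
    qed (simp add: degree_gen)
    then show ?case
      using gen_monoid_unit_segment[OF gens_subset_monoid(1)] open_poly_vimage by blast
  next
    case gen2
    have "connected (poly gen2 -` K)" if K: "open K" "connected K" "unit_segment \<subseteq> K" for K
    proof (rule connected_poly_vimage[OF _ K(1,2), where S = "{0}" and w = 0])
      show "0 \<in> K" "{0} \<subseteq> poly gen2 -` K"
        using K(3) zero_in_unit_segment by (auto simp: poly_gen2)
    qed (auto simp: degree_gen poly_gen2)
    then show ?case
      using gen_monoid_unit_segment[OF gens_subset_monoid(2)] open_poly_vimage by blast
  next
    case gen3
    have "connected (poly gen3 -` K)" if K: "open K" "connected K" "unit_segment \<subseteq> K" for K
    proof (rule connected_poly_vimage[OF _ K(1,2), where S = "{0}" and w = 0])
      show "0 \<in> K" "{0} \<subseteq> poly gen3 -` K"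
        using K(3) zero_in_unit_segment by (auto simp: poly_gen3)
    qed (auto simp: degree_gen poly_gen3)
    then show ?case
      using gen_monoid_unit_segment[OF gens_subset_monoid(3)] open_poly_vimage by blast
  next
    case (comp f g)
    have "(\<lambda>z. f (g z)) -` K = g -` (f -` K)" for K by auto
    with comp show ?case by metis
  qed auto
  then show "\<And>K. open K \<Longrightarrow> connected K \<Longrightarrow> unit_segment \<subseteq> K \<Longrightarrow> connected (poly g -` K)" by blast
qed

text \<open>The preimage under \<open>g\<close> of the circle \<open>|z| = 4\<close>, which is
  \<open>J(gen3)\<close>.\<close>

definition level :: "complex poly \<Rightarrow> complex set" where
  "level g = {z. cmod (poly g z) = 4}"

lemma connected_level: "g \<in> gen_monoid \<Longrightarrow> connected (level g)"
  unfolding level_def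
proof (rule connected_poly_level_set)
  assume g: "g \<in> gen_monoid"
  show "degree g > 0" using g by (rule gen_monoid_degree)
  have "unit_segment \<subseteq> ball 0 4" using norm_unit_segment by force
  then have "connected (poly g -` ball 0 4)"
    using g by (intro gen_monoid_connected_vimage) auto
  moreover have "poly g -` ball 0 4 = {z. cmod (poly g z) < 4}" by auto
  ultimately show "connected {z. cmod (poly g z) < 4}" by simp
qed simp

lemma level_pcompose: "level (f \<circ>\<^sub>p g) = poly g -` level f"
  by (auto simp: level_def poly_pcompose)

lemma level_norm_bounds:
  assumes "g \<in> gen_monoid" "z \<in> level g"
  shows "1 / 4 \<le> cmod z" "cmod z \<le> 4"
  using gen_monoid_norm_less[OF assms(1), of z] gen_monoid_norm_gt[OF assms(1), of z] assms(2)
  by (auto simp: level_def linorder_not_less[symmetric])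

text \<open>The level sets of \<open>g \<circ> gen1\<close> reach both inside the circle \<open>\<bar>z\<bar> = 19/20\<close> and outside the
  circle \<open>\<bar>z\<bar> = 3/2\<close>, whereas those of \<open>g \<circ> gen2\<close> separate these two circles.\<close>

lemma levels_meet:
  assumes g: "g \<in> gen_monoid" and g': "g' \<in> gen_monoid"
  shows "level (g \<circ>\<^sub>p gen1) \<inter> level (g' \<circ>\<^sub>p gen2) \<noteq> {}"
proof -
  \<comment> \<open>At a zero of \<open>gen1\<close> the modulus of \<open>g \<circ> gen1\<close> is
    at most 1, as \<open>g\<close> keeps 0 in the segment; where \<open>|gen1| \<ge> 4\<close> it is
    at least 4.\<close>
  have hit: "\<exists>x\<in>{a..b}. of_real x \<in> level (g \<circ>\<^sub>p gen1)"
    if "a \<le> b" "poly gen1 (of_real u) = 0" "4 \<le> cmod (poly gen1 (of_real v))" "u \<in> {a..b}" "v \<in> {a..b}"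
    for a b u v
  proof -
    have "cmod (poly g 0) \<le> 1"
      using gen_monoid_unit_segment[OF g zero_in_unit_segment] norm_unit_segment by blast
    moreover have "4 \<le> cmod (poly g (poly gen1 (of_real v)))"
      using gen_monoid_norm_ge[OF g that(3)] that(3) by linarith
    ultimately have "\<exists>z\<in>complex_of_real ` {a..b}. cmod (poly (g \<circ>\<^sub>p gen1) z) = 4"
      using that by (intro connected_norm_ivt[of _ _ "of_real u" "of_real v"])
        (auto intro!: connected_continuous_image continuous_intros simp: poly_pcompose)
    then show ?thesis by (auto simp: level_def)
  qed
  have z: "poly gen1 (of_real 0) = 0" "poly gen1 (of_real (3 / 2)) = 0"
    by (simp_all add: poly_gen1)
  have gen1_real: "cmod (poly gen1 (of_real x)) = \<bar>x\<^sup>2 * (3 - 2 * x)\<bar>" for x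
  proof -
    have "poly gen1 (of_real x) = of_real (x\<^sup>2 * (3 - 2 * x))" by (simp add: poly_gen1)
    then show ?thesis by (simp only: norm_of_real)
  qed
  \<comment> \<open>\<open>gen1\<close> is about 4.42 at \<open>-19/20\<close> and equals
    \<open>-4\<close> at 2.\<close>
  have big: "4 \<le> cmod (poly gen1 (of_real (- 19 / 20)))" "4 \<le> cmod (poly gen1 (of_real 2))"
    unfolding gen1_real by (simp_all add: power2_eq_square)
  obtain t where t: "t \<in> {- 19 / 20..0}" "of_real t \<in> level (g \<circ>\<^sub>p gen1)"
    using hit[OF _ z(1) big(1), of "- 19 / 20" 0] by auto
  obtain s where s: "s \<in> {3 / 2..2}" "of_real s \<in> level (g \<circ>\<^sub>p gen1)"
    using hit[OF _ z(2) big(2), of "3 / 2" 2] by auto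
  \<comment> \<open>Within radius \<open>19/20\<close>, \<open>gen2\<close> lands in the invariant
    disc of radius \<open>1/4\<close>; beyond radius \<open>3/2\<close> it lands in
    \<open>|w| \<ge> 4\<close>, where no word decreases the modulus.\<close>
  have "\<bar>t\<bar> ^ 32 \<le> (19 / 20) ^ 32" using t(1) by (intro power_mono) auto
  also have "(19 / 20 :: real) ^ 32 < 1 / 4" by (simp add: field_simps)
  finally have "cmod (poly gen2 (of_real t)) < 1 / 4" by (simp add: norm_gen2)
  then have lt4: "cmod (poly (g' \<circ>\<^sub>p gen2) (of_real t)) \<le> 4"
    using gen_monoid_norm_less[OF g'] by (force simp: poly_pcompose)
  have "(4::real) \<le> (3 / 2) ^ 32" by (simp add: field_simps)
  moreover have "(3 / 2) ^ 32 \<le> \<bar>s\<bar> ^ 32" using s(1) by (intro power_mono) auto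
  ultimately have "4 \<le> \<bar>s\<bar> ^ 32" by linarith
  then have "4 \<le> cmod (poly gen2 (of_real s))" by (simp add: norm_gen2)
  then have "4 \<le> cmod (poly (g' \<circ>\<^sub>p gen2) (of_real s))"
    using gen_monoid_norm_ge[OF g'] by (force simp: poly_pcompose)
  \<comment> \<open>The connected level set of \<open>g \<circ> gen1\<close> has points on both
    sides of that of \<open>g' \<circ> gen2\<close>.\<close>
  with lt4 have "\<exists>z\<in>level (g \<circ>\<^sub>p gen1). cmod (poly (g' \<circ>\<^sub>p gen2) z) = 4"
    using t s g by (intro connected_norm_ivt[OF connected_level])
      (auto intro!: gen_monoid_compose gens_subset_monoid continuous_intros)
  then show ?thesis by (auto simp: level_def)
qed

section \<open>The Julia set\<close>

text \<open>The words whose first applied generator is \<open>gen1\<close> or \<open>gen2\<close>,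
  in two families because the crossings in \<open>levels_meet\<close> are between different
  families.\<close>

definition seed :: "complex set" where
  "seed = (\<Union>g\<in>gen_monoid. level (g \<circ>\<^sub>p gen1)) \<union> (\<Union>g\<in>gen_monoid. level (g \<circ>\<^sub>p gen2))"

definition planar_julia :: "complex set" where
  "planar_julia = closure (\<Union>g\<in>gen_monoid. level g)"

definition julia_core :: "complex set" where
  "julia_core = closure seed"

text \<open>Every \<open>?A g\<close> meets every \<open>?B g'\<close>, so the two families of
  connected sets have a connected union. A general \<open>p\<close> is taken to cover the preimages
  under iterates of \<open>gen3\<close>.\<close>

lemma connected_seed_vimage:
  assumes p: "p \<in> gen_monoid"
  shows "connected (poly p -` seed)"
proof -
  let ?A = "\<lambda>g. poly p -` level (g \<circ>\<^sub>p gen1)" and ?B = "\<lambda>g. poly p -` level (g \<circ>\<^sub>p gen2)"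
  have A: "connected (?A g)" and B: "connected (?B g)" if "g \<in> gen_monoid" for g
    using that p by (auto simp flip: level_pcompose intro!: connected_level gen_monoid_compose gens_subset_monoid)
  have meet: "?A g \<inter> ?B g' \<noteq> {}" if "g \<in> gen_monoid" "g' \<in> gen_monoid" for g g'
  proof -
    obtain w where "w \<in> level (g \<circ>\<^sub>p gen1)" "w \<in> level (g' \<circ>\<^sub>p gen2)"
      using levels_meet \<open>g \<in> gen_monoid\<close> \<open>g' \<in> gen_monoid\<close> by blast
    moreover obtain z where "poly p z = w" using poly_surj[OF gen_monoid_degree[OF p]] by blast
    ultimately show ?thesis by blast
  qed
  have id: "[:0, 1:] \<in> gen_monoid" by (rule gens_subset_monoid)
  have row: "connected (\<Union>g'\<in>gen_monoid. ?A g \<union> ?B g')" if g: "g \<in> gen_monoid" for g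
  proof (rule connected_Union)
    show "connected T" if "T \<in> (\<lambda>g'. ?A g \<union> ?B g') ` gen_monoid" for T
      using that by (auto intro!: connected_Un A[OF g] B meet[OF g])
    have "?A g \<noteq> {}" using meet[OF g id] by blast
    then show "(\<Inter>g'\<in>gen_monoid. ?A g \<union> ?B g') \<noteq> {}" by blast
  qed
  \<comment> \<open>Within a row all sets share \<open>?A g\<close>; all rows share
    \<open>?B\<close> of the identity.\<close>
  have "connected (\<Union>g\<in>gen_monoid. \<Union>g'\<in>gen_monoid. ?A g \<union> ?B g')"
  proof (rule connected_Union)
    have "?B [:0, 1:] \<noteq> {}" using meet[OF id id] by blast
    then show "(\<Inter>g\<in>gen_monoid. \<Union>g'\<in>gen_monoid. ?A g \<union> ?B g') \<noteq> {}" using id by blast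
    show "connected T" if "T \<in> (\<lambda>g. \<Union>g'\<in>gen_monoid. ?A g \<union> ?B g') ` gen_monoid" for T
      using that row by (elim imageE) (simp only:)
  qed
  moreover have "(\<Union>g\<in>gen_monoid. \<Union>g'\<in>gen_monoid. ?A g \<union> ?B g') = poly p -` seed"
    unfolding seed_def using id by blast
  ultimately show ?thesis by simp
qed

text \<open>Words are sorted by the generator applied first: \<open>gen1\<close> and
  \<open>gen2\<close> give \<open>seed\<close>, \<open>gen3\<close> gives the preimage. The empty
  word falls under \<open>gen3\<close> because the circle \<open>|z| = 4\<close> is
  invariant.\<close>

lemma union_levels_eq: "(\<Union>g\<in>gen_monoid. level g) = seed \<union> poly gen3 -` (\<Union>g\<in>gen_monoid. level g)"
proof
  show "(\<Union>g\<in>gen_monoid. level g) \<subseteq> seed \<union> poly gen3 -` (\<Union>g\<in>gen_monoid. level g)"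
  proof clarify
    fix g z assume g: "g \<in> gen_monoid" and z: "z \<in> level g"
      and n: "z \<notin> poly gen3 -` (\<Union>g\<in>gen_monoid. level g)"
    from g show "z \<in> seed"
    proof (cases rule: gen_monoid_cases)
      case 1
      then have "cmod (poly gen3 z) = 4" using z by (simp add: level_def norm_gen3)
      then have "poly gen3 z \<in> level [:0, 1:]" by (simp add: level_def)
      then show ?thesis using n gens_subset_monoid(4) by blast
    next
      case (2 f h)
      then show ?thesis using n z by (auto simp: gens_def level_pcompose seed_def)
    qed
  qed
  show "seed \<union> poly gen3 -` (\<Union>g\<in>gen_monoid. level g) \<subseteq> (\<Union>g\<in>gen_monoid. level g)"
    unfolding seed_def vimage_UN level_pcompose[symmetric]
    using gen_monoid_compose gens_subset_monoid by blast
qed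

lemma planar_julia_eq: "planar_julia = julia_core \<union> poly gen3 -` planar_julia"
  unfolding planar_julia_def julia_core_def
  by (subst union_levels_eq) (simp add: closure_poly_vimage degree_gen)

lemma closed_planar_julia: "closed planar_julia"
  by (simp add: planar_julia_def)

lemma planar_julia_norm:
  assumes "z \<in> planar_julia"
  shows "1 / 4 \<le> cmod z" "cmod z \<le> 4"
proof -
  have "(\<Union>g\<in>gen_monoid. level g) \<subseteq> cball 0 4 - ball 0 (1 / 4)"
    using level_norm_bounds by force
  then have "planar_julia \<subseteq> cball 0 4 - ball 0 (1 / 4)"
    unfolding planar_julia_def by (rule closure_minimal) (auto intro: closed_Diff)
  then show "1 / 4 \<le> cmod z" "cmod z \<le> 4" using assms by auto
qed

lemma julia_core_subset: "julia_core \<subseteq> planar_julia"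
  using planar_julia_eq by blast

text \<open>Where \<open>|z| > 2\<close>, both \<open>gen1\<close> and \<open>gen2\<close> have
  modulus above 4, beyond the reach of any level set.\<close>

lemma julia_core_norm:
  assumes "z \<in> julia_core"
  shows "cmod z \<le> 2"
proof -
  have "cmod z \<le> 2" if z: "z \<in> seed" for z
  proof (rule ccontr)
    assume "\<not> ?thesis"
    then have z2: "2 < cmod z" by simp
    from z obtain g h where g: "g \<in> gen_monoid" "h = gen1 \<or> h = gen2" "poly h z \<in> level g"
      by (auto simp: seed_def level_pcompose)
    have "4 < cmod (poly h z)" using g(2)
    proof
      assume h: "h = gen1"
      have "4 * 1 < (cmod z)\<^sup>2 * (2 * cmod z - 3)"
        using z2 power_strict_mono[of 2 "cmod z" 2] by (intro mult_strict_mono) auto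
      then show ?thesis using norm_gen1_ge[of z] h by simp
    next
      assume h: "h = gen2"
      have "2 ^ 32 < cmod z ^ 32" using z2 by (intro power_strict_mono) auto
      then show ?thesis using h by (simp add: norm_gen2)
    qed
    then show False using level_norm_bounds(2)[OF g(1,3)] by simp
  qed
  then have "julia_core \<subseteq> cball 0 2"
    unfolding julia_core_def by (intro closure_minimal) auto
  then show ?thesis using assms by auto
qed

lemma planar_julia_vimage_gen1: "poly gen1 z \<in> planar_julia \<Longrightarrow> z \<in> planar_julia"
proof -
  assume "poly gen1 z \<in> planar_julia"
  then have "z \<in> closure (poly gen1 -` (\<Union>g\<in>gen_monoid. level g))"
    unfolding planar_julia_def by (simp add: closure_poly_vimage degree_gen)
  moreover have "poly gen1 -` (\<Union>g\<in>gen_monoid. level g) \<subseteq> (\<Union>g\<in>gen_monoid. level g)"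
    unfolding vimage_UN level_pcompose[symmetric]
    using gen_monoid_compose gens_subset_monoid by blast
  ultimately show ?thesis
    unfolding planar_julia_def by (rule subsetD[OF closure_mono, rotated])
qed

lemma planar_julia_vimage_gen3: "poly gen3 z \<in> planar_julia \<Longrightarrow> z \<in> planar_julia"
  using planar_julia_eq by blast

text \<open>The upper bound comes from the omitted circle \<open>|w| = 4\<close>. For the lower
  bound, iterates of \<open>gen3\<close> after \<open>g\<close> show that \<open>level g\<close>
  consists of Julia points, and the Julia set is closed.\<close>

lemma julia_set_gens: "julia_set (semigroup_generated gens) = Pt ` planar_julia"
proof
  show "julia_set (semigroup_generated gens) \<subseteq> Pt ` planar_julia"
  proof (rule julia_set_subset[where s = 4])
    fix g z assume g: "g \<in> semigroup_generated gens"
    then have gm: "g \<in> gen_monoid" by (simp add: gen_monoid_def)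
    show "degree g > 0" using gm by (rule gen_monoid_degree)
    show "cmod (poly g z) \<noteq> 4" if "z \<notin> planar_julia"
    proof
      assume "cmod (poly g z) = 4"
      then have "z \<in> (\<Union>g\<in>gen_monoid. level g)" using gm by (auto simp: level_def)
      with that show False
        unfolding planar_julia_def using subsetD[OF closure_subset] by metis
    qed
    show "4 < cmod z \<Longrightarrow> 4 < cmod (poly g z)" using gm by (rule gen_monoid_norm_gt)
  qed (auto intro: closed_planar_julia)
  have "Pt z \<in> julia_set (semigroup_generated gens)" if "g \<in> gen_monoid" "z \<in> level g" for g z
  proof (rule monomial_circle_subset_julia_set[OF norm_gen3_monomial])
    show "poly_iter gen3 (Suc n) \<circ>\<^sub>p g \<in> semigroup_generated gens" for n
      using that(1) by (intro semigroup_compose_monoid poly_iter_in_semigroup) (auto simp: gens_def)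
  qed (use that in \<open>auto simp: level_def gen_monoid_degree\<close>)
  then have "Pt ` (\<Union>g\<in>gen_monoid. level g) \<subseteq> julia_set (semigroup_generated gens)" by blast
  then show "Pt ` planar_julia \<subseteq> julia_set (semigroup_generated gens)"
    unfolding planar_julia_def
    by (intro image_closure_subset[OF continuous_on_Pt closed_julia_set])
qed

text \<open>The unit circle is \<open>J(gen2)\<close>, and \<open>gen3\<close> maps it to radius
  \<open>1/256\<close>, inside the disc free of Julia points; by \<open>planar_julia_eq\<close> it
  lies in the core.\<close>

lemma unit_circle_subset_julia_core: "cmod z = 1 \<Longrightarrow> z \<in> julia_core"
proof -
  assume z: "cmod z = 1"
  have "Pt z \<in> julia_set (semigroup_generated gens)"
  proof (rule monomial_circle_subset_julia_set[OF norm_gen2_monomial, where g = "[:0, 1:]"])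
    show "poly_iter gen2 (Suc n) \<circ>\<^sub>p [:0, 1:] \<in> semigroup_generated gens" for n
      using poly_iter_in_semigroup[of gen2 gens n] by (simp add: gens_def)
  qed (use z in auto)
  then have "z \<in> planar_julia" by (auto simp: julia_set_gens)
  moreover have "poly gen3 z \<notin> planar_julia"
    using z planar_julia_norm(1)[of "poly gen3 z"] by (auto simp: norm_gen3)
  ultimately show ?thesis using planar_julia_eq by blast
qed

text \<open>The core is a continuum through 1 and -1, so 1 is interior to the Julia set. In
  \<open>|z| < 2\<close> the Julia set agrees with the core, because \<open>gen3\<close> sends this
  disc into \<open>|w| \<le> 1/8\<close>.\<close>

lemma one_in_interior_julia_core: "1 \<in> interior julia_core"
proof -
  have "1 \<in> interior planar_julia"
  proof (rule superattracting_fixed_point_in_interior[where p = gen1 and K = julia_core and b = "-1"])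
    show "connected julia_core"
      using connected_seed_vimage[OF gens_subset_monoid(4)]
      by (simp add: julia_core_def connected_imp_connected_closure vimage_def)
    show "poly (pderiv gen1) 1 = 0" by (simp add: gen1_def pderiv_pCons)
    show "julia_core \<subseteq> planar_julia" by (rule julia_core_subset)
    show "poly gen1 z \<in> planar_julia \<Longrightarrow> z \<in> planar_julia" for z
      by (rule planar_julia_vimage_gen1)
  qed (auto simp: degree_gen poly_gen1 closed_planar_julia
      unit_circle_subset_julia_core)
  moreover have "1 \<in> interior (ball 0 2 :: complex set)" by simp
  ultimately have "1 \<in> interior (planar_julia \<inter> ball 0 2)" by (simp only: interior_Int IntI)
  moreover have "planar_julia \<inter> ball 0 2 \<subseteq> julia_core"
  proof
    fix z assume z: "z \<in> planar_julia \<inter> ball 0 2"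
    then have "cmod z ^ 5 \<le> 2 ^ 5" by (intro power_mono) auto
    then have "cmod (poly gen3 z) < 1 / 4" by (simp add: norm_gen3)
    then have "poly gen3 z \<notin> planar_julia" using planar_julia_norm(1) by force
    then show "z \<in> julia_core" using z planar_julia_eq by blast
  qed
  ultimately show ?thesis by (rule subsetD[OF interior_mono, rotated])
qed

section \<open>The components of the Julia set\<close>

abbreviation gen3_iter :: "nat \<Rightarrow> complex \<Rightarrow> complex" where
  "gen3_iter n \<equiv> poly (poly_iter gen3 n)"

text \<open>These turn out to be the components other than the circle \<open>|z| = 4\<close>;
  \<open>shell 0\<close> is the core.\<close>

definition shell :: "nat \<Rightarrow> complex set" where
  "shell n = gen3_iter n -` julia_core"

lemma gen3_iter_Suc: "gen3_iter (Suc n) z = poly gen3 (gen3_iter n z)"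
  by (simp add: poly_pcompose)

lemma norm_gen3_iter: "cmod (gen3_iter n z) = 4 * (cmod z / 4) ^ (5 ^ n)"
  by (rule norm_poly_iter_monomial[OF norm_gen3_monomial]) simp

lemma gen3_iter_in_gen_monoid: "poly_iter gen3 n \<in> gen_monoid"
  by (intro poly_iter_in_monoid gens_subset_monoid)

text \<open>Once an iterate is within radius 2, each later one is within
  \<open>2^5 / 256 = 1/8\<close>.\<close>

lemma gen3_iter_le:
  assumes "cmod (gen3_iter j z) \<le> 2" "j < n"
  shows "cmod (gen3_iter n z) \<le> 1 / 8"
  using assms(2)
proof (induction n)
  case (Suc n)
  have "cmod (gen3_iter n z) \<le> 2"
    using Suc assms(1) by (cases "j = n") auto
  then have "cmod (gen3_iter n z) ^ 5 \<le> 2 ^ 5" by (intro power_mono) auto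
  then show ?case by (simp add: gen3_iter_Suc norm_gen3 del: poly_iter_simps)
qed simp

lemma planar_julia_vimage_gen3_iter: "gen3_iter n z \<in> planar_julia \<Longrightarrow> z \<in> planar_julia"
proof (induction n)
  case (Suc n)
  then show ?case using planar_julia_vimage_gen3 unfolding gen3_iter_Suc by metis
qed simp

lemma shell_subset: "shell n \<subseteq> planar_julia"
  using planar_julia_vimage_gen3_iter julia_core_subset unfolding shell_def by blast

lemma shell_norm:
  assumes "z \<in> shell n"
  shows "1 / 4 \<le> cmod (gen3_iter n z)" "cmod (gen3_iter n z) \<le> 2"
proof -
  have "gen3_iter n z \<in> julia_core" using assms by (simp add: shell_def)
  then show "1 / 4 \<le> cmod (gen3_iter n z)" "cmod (gen3_iter n z) \<le> 2"
    using planar_julia_norm(1) julia_core_norm subsetD[OF julia_core_subset] by metis+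
qed

lemma planar_julia_cases:
  assumes "z \<in> planar_julia"
  shows "(\<exists>j<n. z \<in> shell j) \<or> gen3_iter n z \<in> planar_julia"
proof (induction n)
  case (Suc n)
  from Suc consider j where "j < n" "z \<in> shell j" | "gen3_iter n z \<in> planar_julia" by blast
  then show ?case
  proof cases
    case 1
    then show ?thesis using less_SucI by blast
  next
    case 2
    then have "gen3_iter n z \<in> julia_core \<union> poly gen3 -` planar_julia"
      by (simp only: planar_julia_eq[symmetric])
    then have "z \<in> shell n \<or> gen3_iter (Suc n) z \<in> planar_julia"
      unfolding gen3_iter_Suc shell_def by simp
    then show ?thesis by blast
  qed
qed (use assms in simp)

text \<open>The annulus \<open>1/8 < |w| < 9/4\<close> is an open neighborhood of
  \<open>1/4 \<le> |w| \<le> 2\<close>, which holds the core. Its lower bound rules out earlier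
  shells; its upper bound rules out another step of \<open>gen3\<close>, since
  \<open>(9/4)^5 < 64 = 256 / 4\<close>.\<close>

lemma planar_julia_shellI:
  assumes z: "z \<in> planar_julia" and b: "1 / 8 < cmod (gen3_iter n z)" "cmod (gen3_iter n z) < 9 / 4"
  shows "z \<in> shell n"
proof -
  have "\<not> (\<exists>j<n. z \<in> shell j)" using gen3_iter_le shell_norm(2) b(1) by force
  then have "gen3_iter n z \<in> planar_julia" using planar_julia_cases[OF z, of n] by blast
  then have "gen3_iter n z \<in> julia_core \<union> poly gen3 -` planar_julia"
    by (simp only: planar_julia_eq[symmetric])
  moreover have "poly gen3 (gen3_iter n z) \<notin> planar_julia"
  proof
    assume "poly gen3 (gen3_iter n z) \<in> planar_julia"
    then have "64 \<le> cmod (gen3_iter n z) ^ 5"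
      using planar_julia_norm(1) by (fastforce simp: norm_gen3)
    moreover have "cmod (gen3_iter n z) ^ 5 \<le> (9 / 4) ^ 5" using b(2) by (intro power_mono) auto
    moreover have "(9 / 4 :: real) ^ 5 < 64" by (simp add: eval_nat_numeral)
    ultimately show False by linarith
  qed
  ultimately show ?thesis by (simp add: shell_def)
qed

lemma sphere_subset_planar_julia: "sphere 0 4 \<subseteq> planar_julia"
proof -
  have "sphere 0 4 = level [:0, 1:]" by (auto simp: level_def)
  then have "sphere 0 4 \<subseteq> (\<Union>g\<in>gen_monoid. level g)" using gens_subset_monoid(4) by blast
  then show ?thesis unfolding planar_julia_def by (rule subset_trans[OF _ closure_subset])
qed

text \<open>If \<open>|z| < 4\<close>, the orbit under \<open>gen3\<close> tends to 0 and leaves the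
  Julia set, so the recursion \<open>planar_julia_eq\<close> must have stopped in some
  shell.\<close>

lemma planar_julia_eq_shells: "planar_julia = sphere 0 4 \<union> (\<Union>n. shell n)"
proof
  show "sphere 0 4 \<union> (\<Union>n. shell n) \<subseteq> planar_julia"
    using sphere_subset_planar_julia shell_subset by blast
  show "planar_julia \<subseteq> sphere 0 4 \<union> (\<Union>n. shell n)"
  proof
    fix z assume z: "z \<in> planar_julia"
    show "z \<in> sphere 0 4 \<union> (\<Union>n. shell n)"
    proof (rule ccontr)
      assume n: "\<not> ?thesis"
      then have lt: "cmod z / 4 < 1" using planar_julia_norm(2)[OF z] by simp
      obtain k where "(cmod z / 4) ^ k < 1 / 16"
        using real_arch_pow_inv[OF _ lt, of "1 / 16"] by auto
      moreover have "(cmod z / 4) ^ (5 ^ k) \<le> (cmod z / 4) ^ k"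
        using lt by (intro power_decreasing) (auto simp: less_imp_le)
      ultimately have "cmod (gen3_iter k z) < 1 / 4" unfolding norm_gen3_iter by simp
      moreover have "gen3_iter k z \<in> planar_julia" using n planar_julia_cases[OF z, of k] by blast
      ultimately show False using planar_julia_norm(1) by force
    qed
  qed
qed

lemma connected_shell: "connected (shell n)"
proof -
  have "shell n = closure (gen3_iter n -` seed)"
    unfolding shell_def julia_core_def
    by (intro closure_poly_vimage[symmetric] gen_monoid_degree gen3_iter_in_gen_monoid)
  then show ?thesis
    using connected_seed_vimage[OF gen3_iter_in_gen_monoid] connected_imp_connected_closure by metis
qed

lemma shell_nonempty: "shell n \<noteq> {}"
proof -
  have "1 \<in> julia_core" by (intro unit_circle_subset_julia_core) simp
  moreover obtain z where "gen3_iter n z = 1"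
    using poly_surj[OF gen_monoid_degree[OF gen3_iter_in_gen_monoid]] by blast
  ultimately have "z \<in> shell n" by (simp add: shell_def)
  then show ?thesis by blast
qed

lemma shell_later:
  assumes "z \<in> shell m" "n < m"
  shows "2 < cmod (gen3_iter n z)"
  using gen3_iter_le[of n z m] shell_norm(1)[OF assms(1)] assms(2) by force

lemma norm_gen3_iter_sphere: "z \<in> sphere 0 4 \<Longrightarrow> cmod (gen3_iter n z) = 4"
  unfolding norm_gen3_iter by simp

lemma shell_disjoint: "m < n \<Longrightarrow> shell m \<inter> shell n = {}"
  using shell_later shell_norm(2) by fastforce

lemma shell_disjoint_sphere: "shell n \<inter> sphere 0 4 = {}"
  using norm_gen3_iter_sphere shell_norm(2) by fastforce

lemma inj_shell: "inj shell"
  by (rule linorder_injI) (metis inf.idem shell_disjoint shell_nonempty)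

text \<open>Within the Julia set, \<open>shell n\<close> is cut out by an open and also by a closed
  annulus for \<open>gen3_iter n\<close>, so its trace on \<open>C\<close> is clopen.\<close>

lemma connected_subset_shell:
  assumes C: "connected C" "C \<subseteq> planar_julia" "C \<inter> shell n \<noteq> {}"
  shows "C \<subseteq> shell n"
proof -
  let ?O = "gen3_iter n -` (ball 0 (9 / 4) - cball 0 (1 / 8))"
  let ?T = "gen3_iter n -` (cball 0 2 - ball 0 (1 / 4))"
  have O: "C \<inter> shell n = C \<inter> ?O"
    using shell_norm[of _ n] planar_julia_shellI[of _ n] C(2) by force
  have T: "C \<inter> shell n = C \<inter> ?T"
    using shell_norm[of _ n] planar_julia_shellI[of _ n] C(2) by force
  have "openin (top_of_set C) (C \<inter> shell n)"
    unfolding O by (intro openin_open_Int open_poly_vimage open_Diff) auto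
  moreover have "closedin (top_of_set C) (C \<inter> shell n)"
    unfolding T by (intro closedin_closed_Int closed_poly_vimage closed_Diff) auto
  ultimately have "C \<inter> shell n = C" using C(1,3) unfolding connected_clopen by metis
  then show ?thesis by blast
qed

lemma components_planar_julia: "components planar_julia = insert (sphere 0 4) (range shell)"
proof -
  have sh: "shell n \<in> components planar_julia" for n
    unfolding in_components_maximal
  proof (intro conjI allI impI)
    fix D assume D: "D \<noteq> {} \<and> shell n \<subseteq> D \<and> D \<subseteq> planar_julia \<and> connected D"
    then have "D \<inter> shell n \<noteq> {}" using shell_nonempty by blast
    then have "D \<subseteq> shell n" using D connected_subset_shell by blast
    then show "D = shell n" using D by blast
  qed (use shell_nonempty shell_subset connected_shell in auto)
  have sp: "sphere 0 4 \<in> components planar_julia"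
    unfolding in_components_maximal
  proof (intro conjI allI impI)
    show "sphere 0 4 \<noteq> ({} :: complex set)" by simp
    show "connected (sphere (0 :: complex) 4)" by (intro connected_sphere) simp
    show "sphere 0 4 \<subseteq> planar_julia" by (rule sphere_subset_planar_julia)
    fix D assume D: "D \<noteq> {} \<and> sphere 0 4 \<subseteq> D \<and> D \<subseteq> planar_julia \<and> connected D"
    \<comment> \<open>A connected set meeting a shell lies in it, but shells miss the
      circle.\<close>
    have "D \<inter> shell n = {}" for n
    proof (rule ccontr)
      assume "D \<inter> shell n \<noteq> {}"
      then have "D \<subseteq> shell n" using D connected_subset_shell by blast
      then have "sphere 0 4 \<subseteq> shell n" using D by blast
      then have "sphere 0 4 = (sphere 0 4 \<inter> shell n :: complex set)" by blast
      then show False using shell_disjoint_sphere[of n] by (simp add: Int_commute)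
    qed
    then show "D = sphere 0 4" using D planar_julia_eq_shells by blast
  qed
  have "C \<in> insert (sphere 0 4) (range shell)" if C: "C \<in> components planar_julia" for C
  proof -
    obtain z where "z \<in> C" "z \<in> planar_julia"
      using in_components_nonempty[OF C] in_components_subset[OF C] by blast
    then consider "z \<in> sphere 0 4" | n where "z \<in> shell n" using planar_julia_eq_shells by blast
    then show ?thesis
    proof cases
      case 1
      then show ?thesis using components_nonoverlap[OF C sp] \<open>z \<in> C\<close> by blast
    next
      case 2
      then show ?thesis using components_nonoverlap[OF C sh] \<open>z \<in> C\<close> by blast
    qed
  qed
  with sh sp show ?thesis by blast
qed

text \<open>The set \<open>|gen3_iter n| > 2\<close> is the exterior of a round disc: connected,
  unbounded and disjoint from the shell. A component meeting it would contain it.\<close>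

lemma bounded_component_shell_inner:
  assumes C: "C \<in> components (- shell n)" "bounded C" and z: "z \<in> C"
  shows "cmod (gen3_iter n z) \<le> 2"
proof (rule ccontr)
  assume n: "\<not> ?thesis"
  \<comment> \<open>\<open>r\<close> solves \<open>4 (r / 4)^(5^n) = 2\<close>.\<close>
  define r where "r = 4 * root (5 ^ n) (1 / 2)"
  have out: "2 < cmod (gen3_iter n y) \<longleftrightarrow> r < cmod y" for y
  proof -
    have "2 < cmod (gen3_iter n y) \<longleftrightarrow> 1 / 2 < (cmod y / 4) ^ (5 ^ n)"
      unfolding norm_gen3_iter by auto
    also have "\<dots> \<longleftrightarrow> root (5 ^ n) (1 / 2) < root (5 ^ n) ((cmod y / 4) ^ (5 ^ n))"
      by (intro real_root_less_iff[symmetric]) simp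
    also have "root (5 ^ n) ((cmod y / 4) ^ (5 ^ n)) = cmod y / 4"
      by (intro real_root_power_cancel) auto
    finally show ?thesis by (auto simp: r_def)
  qed
  have "connected (- cball (0 :: complex) r)"
    by (intro connected_complement_bounded_convex) auto
  moreover have "- cball 0 r \<subseteq> - shell n"
  proof (rule subsetI)
    fix y :: complex assume "y \<in> - cball 0 r"
    then have "2 < cmod (gen3_iter n y)" using out[of y] by simp
    then show "y \<in> - shell n" using shell_norm(2)[of y n] by auto
  qed
  moreover have "z \<in> - cball 0 r" using n out[of z] by simp
  ultimately have "- cball 0 r \<subseteq> C"
    using components_maximal[OF C(1)] z by (metis IntI empty_iff)
  then have "bounded (- cball (0 :: complex) r)" using C(2) bounded_subset by blast
  then show False using bounded_cball cobounded_imp_unbounded by blast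
qed

text \<open>The component of 0 is bounded because the shell contains the level set of
  \<open>gen1\<close> after the \<open>n\<close>-th iterate of \<open>gen3\<close>, which separates
  0 from \<open>|z| \<ge> 4\<close>.\<close>

lemma inner_component_shell:
  obtains C where "C \<in> components (- shell n)" "bounded C"
    "\<And>z. cmod (gen3_iter n z) < 1 / 4 \<Longrightarrow> z \<in> C"
proof -
  define r where "r = 4 * root (5 ^ n) (1 / 16)"
  have inn: "cmod (gen3_iter n y) < 1 / 4 \<longleftrightarrow> cmod y < r" for y
  proof -
    have "cmod (gen3_iter n y) < 1 / 4 \<longleftrightarrow> (cmod y / 4) ^ (5 ^ n) < 1 / 16"
      unfolding norm_gen3_iter by auto
    also have "\<dots> \<longleftrightarrow> root (5 ^ n) ((cmod y / 4) ^ (5 ^ n)) < root (5 ^ n) (1 / 16)"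
      by (intro real_root_less_iff[symmetric]) simp
    also have "root (5 ^ n) ((cmod y / 4) ^ (5 ^ n)) = cmod y / 4"
      by (intro real_root_power_cancel) auto
    finally show ?thesis by (auto simp: r_def)
  qed
  have r: "r > 0" by (simp add: r_def)
  have sub: "ball 0 r \<subseteq> - shell n"
  proof (rule subsetI)
    fix y :: complex assume "y \<in> ball 0 r"
    then have "cmod (gen3_iter n y) < 1 / 4" using inn[of y] by simp
    then show "y \<in> - shell n" using shell_norm(1)[of y n] by auto
  qed
  then have "0 \<in> - shell n" using r by (rule subsetD[OF _ iffD2[OF centre_in_ball]])
  then obtain C where C: "C \<in> components (- shell n)" "0 \<in> C"
    using Union_components by blast
  have "ball 0 r \<subseteq> C"
    using components_maximal[OF C(1) connected_ball sub] C(2) r by (metis IntI centre_in_ball empty_iff)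
  moreover have "bounded C"
  proof -
    let ?p = "gen1 \<circ>\<^sub>p poly_iter gen3 n"
    have p: "?p \<in> gen_monoid" by (intro gen_monoid_compose gens_subset_monoid gen3_iter_in_gen_monoid)
    have "level ?p = gen3_iter n -` level ([:0, 1:] \<circ>\<^sub>p gen1)"
      by (simp add: level_pcompose pcompose_idL)
    also have "\<dots> \<subseteq> gen3_iter n -` seed" unfolding seed_def using gens_subset_monoid(4) by blast
    also have "\<dots> \<subseteq> shell n" unfolding shell_def julia_core_def by (intro vimage_mono closure_subset)
    finally have lv: "level ?p \<subseteq> shell n" .
    have "cmod y < 4" if "y \<in> C" for y
    proof (rule ccontr)
      assume y: "\<not> cmod y < 4"
      then have "4 \<le> cmod (poly ?p y)" using gen_monoid_norm_ge[OF p, of y] by simp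
      moreover have "cmod (poly ?p 0) \<le> 4"
        using norm_unit_segment[OF gen_monoid_unit_segment[OF p zero_in_unit_segment]] by simp
      ultimately have "\<exists>z\<in>C. cmod (poly ?p z) = 4"
        using C that in_components_connected[OF C(1)]
        by (intro connected_norm_ivt[of C _ 0 y]) (auto intro!: continuous_intros)
      then obtain u where "u \<in> C" "u \<in> level ?p" by (auto simp: level_def)
      then show False using lv in_components_subset[OF C(1)] by blast
    qed
    then have "C \<subseteq> ball 0 4" by auto
    then show ?thesis using bounded_ball bounded_subset by blast
  qed
  ultimately show ?thesis using that[OF C(1)] inn by force
qed

lemma ball_component_sphere: "ball 0 4 \<in> components (- sphere (0 :: complex) 4)"
  unfolding in_components_maximal
proof (intro conjI allI impI)
  fix D :: "complex set"
  assume D: "D \<noteq> {} \<and> ball 0 4 \<subseteq> D \<and> D \<subseteq> - sphere 0 4 \<and> connected D"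
  have "cmod y < 4" if "y \<in> D" for y
  proof (rule ccontr)
    assume "\<not> cmod y < 4"
    moreover have "0 \<in> D" by (rule subsetD[of "ball 0 4"]) (use D in auto)
    ultimately have "\<exists>z\<in>D. cmod z = 4"
      using D that by (intro connected_norm_ivt[of D "\<lambda>z. z" 0 y]) auto
    then show False using D by auto
  qed
  then show "D = ball 0 4" using D by auto
qed auto

section \<open>The minimal and the maximal component\<close>

lemma julia_components_gens:
  "julia_components (semigroup_generated gens) = insert (Pt ` sphere 0 4) (range (\<lambda>n. Pt ` shell n))"
  unfolding julia_components_def julia_set_gens components_Pt_image components_planar_julia
  by auto

lemma planar_julia_components_gens:
  "planar_julia_components (semigroup_generated gens)
     = insert (Pt ` sphere 0 4) (range (\<lambda>n. Pt ` shell n))"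
  unfolding planar_julia_components_def julia_components_gens by auto

lemma inj_Pt: "inj Pt"
  by (simp add: inj_on_def)

lemma surrounded_by_Pt_image:
  "surrounded_by (Pt ` A) (Pt ` B) \<longleftrightarrow> A = B \<or> (\<exists>C\<in>components (- B). bounded C \<and> A \<subseteq> C)"
  unfolding surrounded_by_def
  by (simp add: inj_image_eq_iff[OF inj_Pt] inj_image_subset_iff[OF inj_Pt] inj_vimage_image_eq[OF inj_Pt]
      Compl_eq_Diff_UNIV)

text \<open>For \<open>m < n\<close>, the \<open>n\<close>-th iterate of \<open>gen3\<close> carries
  \<open>shell m\<close> into radius \<open>1/8\<close>, so \<open>shell m\<close> lies in the inner
  component.\<close>

lemma shell_surrounded_by_shell: "m \<le> n \<Longrightarrow> surrounded_by (Pt ` shell m) (Pt ` shell n)"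
proof (cases "m = n")
  case False
  assume "m \<le> n"
  obtain C where C: "C \<in> components (- shell n)" "bounded C"
    "\<And>z. cmod (gen3_iter n z) < 1 / 4 \<Longrightarrow> z \<in> C" using inner_component_shell by blast
  have "shell m \<subseteq> C"
  proof
    fix z assume "z \<in> shell m"
    then have "cmod (gen3_iter n z) \<le> 1 / 8"
      using shell_norm(2) False \<open>m \<le> n\<close> by (intro gen3_iter_le[of m]) auto
    then show "z \<in> C" by (intro C(3)) simp
  qed
  then show ?thesis using C unfolding surrounded_by_Pt_image by blast
qed (simp add: surrounded_by_def)

lemma shell_surrounded_by_sphere: "surrounded_by (Pt ` shell n) (Pt ` sphere 0 4)"
proof -
  have "z \<in> ball 0 4" if z: "z \<in> shell n" for z
  proof -
    have "cmod z \<le> 4" using z shell_subset planar_julia_norm(2) by blast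
    moreover have "z \<notin> sphere 0 4" using z shell_disjoint_sphere[of n] by blast
    ultimately show ?thesis by simp
  qed
  then show ?thesis
    unfolding surrounded_by_Pt_image using ball_component_sphere bounded_ball by blast
qed

lemma not_surrounded_by_shell:
  assumes "\<And>z. z \<in> A \<Longrightarrow> 2 < cmod (gen3_iter n z)" "A \<noteq> {}"
  shows "\<not> surrounded_by (Pt ` A) (Pt ` shell n)"
proof
  obtain z where z: "z \<in> A" using assms(2) by blast
  assume "surrounded_by (Pt ` A) (Pt ` shell n)"
  then consider "A = shell n" | C where "C \<in> components (- shell n)" "bounded C" "A \<subseteq> C"
    unfolding surrounded_by_Pt_image by blast
  then have "cmod (gen3_iter n z) \<le> 2"
    using z shell_norm(2) bounded_component_shell_inner by (metis subsetD)
  then show False using assms(1)[OF z] by simp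
qed

text \<open>Uniqueness holds because every other component lies in \<open>|z| > 2\<close> and so is
  not surrounded by the core.\<close>

lemma J_min_gens: "J_min (semigroup_generated gens) = Pt ` julia_core"
proof -
  have s0: "shell 0 = julia_core" by (auto simp: shell_def)
  have "J_min (semigroup_generated gens) = Pt ` shell 0"
    unfolding J_min_def planar_julia_components_gens
  proof (rule the_equality)
    show "Pt ` shell 0 \<in> insert (Pt ` sphere 0 4) (range (\<lambda>n. Pt ` shell n)) \<and>
      (\<forall>J'\<in>insert (Pt ` sphere 0 4) (range (\<lambda>n. Pt ` shell n)). surrounded_by (Pt ` shell 0) J')"
      using shell_surrounded_by_shell shell_surrounded_by_sphere by blast
    fix J assume J: "J \<in> insert (Pt ` sphere 0 4) (range (\<lambda>n. Pt ` shell n)) \<and>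
      (\<forall>J'\<in>insert (Pt ` sphere 0 4) (range (\<lambda>n. Pt ` shell n)). surrounded_by J J')"
    then have J0: "surrounded_by J (Pt ` shell 0)" by blast
    have "\<not> surrounded_by (Pt ` sphere 0 4) (Pt ` shell 0)"
      by (rule not_surrounded_by_shell) auto
    moreover have "\<not> surrounded_by (Pt ` shell n) (Pt ` shell 0)" if "n \<noteq> 0" for n
      using that by (intro not_surrounded_by_shell shell_nonempty) (erule shell_later, simp)
    moreover from J consider "J = Pt ` sphere 0 4" | n where "J = Pt ` shell n" by auto
    ultimately show "J = Pt ` shell 0" using J0 by cases metis+
  qed
  then show ?thesis by (simp only: s0)
qed

lemma J_max_gens: "J_max (semigroup_generated gens) = Pt ` sphere 0 4"
  unfolding J_max_def planar_julia_components_gens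
proof (rule the_equality)
  show "Pt ` sphere 0 4 \<in> insert (Pt ` sphere 0 4) (range (\<lambda>n. Pt ` shell n)) \<and>
    (\<forall>J'\<in>insert (Pt ` sphere 0 4) (range (\<lambda>n. Pt ` shell n)). surrounded_by J' (Pt ` sphere 0 4))"
    using shell_surrounded_by_sphere by (auto simp: surrounded_by_def)
  fix J assume J: "J \<in> insert (Pt ` sphere 0 4) (range (\<lambda>n. Pt ` shell n)) \<and>
    (\<forall>J'\<in>insert (Pt ` sphere 0 4) (range (\<lambda>n. Pt ` shell n)). surrounded_by J' J)"
  have "\<not> surrounded_by (Pt ` sphere 0 4) (Pt ` shell n)" for n
    by (rule not_surrounded_by_shell) (use norm_gen3_iter_sphere in auto)
  moreover have "surrounded_by (Pt ` sphere 0 4) J" using J by simp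
  moreover from J consider "J = Pt ` sphere 0 4" | n where "J = Pt ` shell n" by auto
  ultimately show "J = Pt ` sphere 0 4" by cases metis+
qed

text \<open>All iterates preserve both sides of the circle, so \<open>julia_set_subset\<close>
  applies with \<open>X\<close> the circle itself.\<close>

lemma julia_set_gen3: "julia_set_of gen3 = Pt ` sphere 0 4"
proof
  have iter: "cmod (poly g z) < 4 \<longleftrightarrow> cmod z < 4" "cmod (poly g z) > 4 \<longleftrightarrow> cmod z > 4"
    if "g \<in> semigroup_generated {gen3}" for g z
  proof -
    have gen3: "cmod (poly gen3 z) < 4 \<longleftrightarrow> cmod z < 4" "cmod (poly gen3 z) > 4 \<longleftrightarrow> cmod z > 4" for z
    proof -
      have "(cmod z / 4) ^ 5 \<le> 1 ^ 5 \<longleftrightarrow> cmod z / 4 \<le> 1" by (rule power_mono_iff) auto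
      then have "1 < (cmod z / 4) ^ 5 \<longleftrightarrow> 1 < cmod z / 4" by (metis not_le power_one)
      moreover have "(cmod z / 4) ^ 5 < 1 \<longleftrightarrow> cmod z / 4 < 1" by (subst power_less_one_iff) auto
      ultimately show "cmod (poly gen3 z) < 4 \<longleftrightarrow> cmod z < 4" "cmod (poly gen3 z) > 4 \<longleftrightarrow> cmod z > 4"
        unfolding norm_gen3_monomial by linarith+
    qed
    have "\<forall>z. (cmod (poly g z) < 4 \<longleftrightarrow> cmod z < 4) \<and> (cmod (poly g z) > 4 \<longleftrightarrow> cmod z > 4)"
      using that by induction (simp_all add: gen3 poly_pcompose)
    then show "cmod (poly g z) < 4 \<longleftrightarrow> cmod z < 4" "cmod (poly g z) > 4 \<longleftrightarrow> cmod z > 4" by blast+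
  qed
  show "julia_set_of gen3 \<subseteq> Pt ` sphere 0 4"
  proof (rule julia_set_subset[where s = 4])
    fix g z assume g: "g \<in> semigroup_generated {gen3}"
    show "degree g > 0" using g by induction (simp_all add: degree_gen degree_pcompose)
    show "z \<notin> sphere 0 4 \<Longrightarrow> cmod (poly g z) \<noteq> 4" using iter[OF g, of z] by auto
    show "4 < cmod z \<Longrightarrow> 4 < cmod (poly g z)" using iter[OF g, of z] by simp
  qed auto
  have "Pt z \<in> julia_set_of gen3" if "cmod z = 4" for z
  proof (rule monomial_circle_subset_julia_set[OF norm_gen3_monomial, where g = "[:0, 1:]"])
    show "poly_iter gen3 (Suc n) \<circ>\<^sub>p [:0, 1:] \<in> semigroup_generated {gen3}" for n
      using poly_iter_in_semigroup[of gen3 "{gen3}" n] by simp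
  qed (use that in auto)
  then show "Pt ` sphere 0 4 \<subseteq> julia_set_of gen3" by auto
qed

text \<open>By the chain rule, a critical point of \<open>f \<circ> g\<close> is critical for
  \<open>g\<close> or is sent by \<open>g\<close> to a critical point of \<open>f\<close>. The
  generators have only the finite critical points 0 and 1, and the segment is forward
  invariant.\<close>

lemma gens_critical_values:
  assumes "g \<in> semigroup_generated gens" "poly (pderiv g) z = 0"
  shows "poly g z \<in> unit_segment"
  using assms
proof (induction arbitrary: z)
  case (generator h)
  have "poly (pderiv gen1) z = 6 * z * (1 - z)"
    by (simp add: gen1_def pderiv_pCons algebra_simps)
  moreover have "poly (pderiv gen2) z = 32 * z ^ 31" "poly (pderiv gen3) z = 5 / 256 * z ^ 4"
    by (simp_all add: gen2_def gen3_def pderiv_monom poly_monom)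
  ultimately have "z = 0 \<or> z = 1" using generator unfolding gens_def by auto
  moreover have "1 \<in> unit_segment" unfolding unit_segment_def by (intro image_eqI[of _ _ 1]) auto
  ultimately have "z \<in> unit_segment" using zero_in_unit_segment by blast
  moreover have "h \<in> gen_monoid" using generator by (simp add: gen_monoid_def semigroup_generated.generator)
  ultimately show ?case by (intro gen_monoid_unit_segment)
next
  case (compose f g)
  then have "poly (pderiv f) (poly g z) = 0 \<or> poly (pderiv g) z = 0"
    by (simp add: pderiv_pcompose poly_pcompose)
  then show ?case
  proof
    assume "poly (pderiv g) z = 0"
    moreover have "f \<in> gen_monoid" using compose(1) by (simp add: gen_monoid_def)
    ultimately show ?thesis using compose(4) by (simp add: poly_pcompose gen_monoid_unit_segment)
  qed (use compose(3) in \<open>simp add: poly_pcompose\<close>)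
qed

lemma gens_postcritically_bounded:
  "semigroup_generated gens \<in> postcritically_bounded_semigroups"
proof -
  have "polynomial_semigroup (semigroup_generated gens)"
    unfolding polynomial_semigroup_def
    by (intro exI[of _ gens]) (auto simp: gens_def degree_gen)
  moreover have "bounded (Pt -` planar_postcritical_set (semigroup_generated gens))"
  proof -
    \<comment> \<open>\<open>Infty\<close> is fixed by every map, so it contributes only itself as a
      critical value.\<close>
    let ?K = "insert Infty (Pt ` unit_segment)"
    have "compact (Pt ` unit_segment)"
      unfolding unit_segment_def
      by (intro compact_continuous_image continuous_on_Pt continuous_intros) auto
    then have "closed ?K" by (simp add: compact_imp_closed)
    moreover have "critical_values g \<subseteq> ?K" if g: "g \<in> semigroup_generated gens" for g
    proof -
      have "sphere_map g x \<in> ?K" if "critical_point g x" for x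
        using that gens_critical_values[OF g] by (cases x) auto
      then show ?thesis unfolding critical_values_def by blast
    qed
    ultimately have "postcritical_set (semigroup_generated gens) \<subseteq> ?K"
      unfolding postcritical_set_def by (intro closure_minimal UN_least)
    then have "Pt -` planar_postcritical_set (semigroup_generated gens) \<subseteq> unit_segment"
      unfolding planar_postcritical_set_def by auto
    moreover have "bounded unit_segment"
      unfolding bounded_iff using norm_unit_segment by blast
    ultimately show ?thesis by (rule bounded_subset[rotated])
  qed
  ultimately show ?thesis
    unfolding postcritically_bounded_semigroups_def using semigroup_degree by blast
qed

lemma julia_components_gens_eqpoll: "julia_components (semigroup_generated gens) \<approx> (UNIV :: nat set)"
proof -
  let ?S = "julia_components (semigroup_generated gens)"
  have "inj (\<lambda>n. Pt ` shell n)"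
    using inj_shell inj_image_eq_iff[OF inj_Pt] unfolding inj_def by metis
  then have "infinite (range (\<lambda>n. Pt ` shell n))" by (rule range_inj_infinite)
  then have "infinite ?S" unfolding julia_components_gens by simp
  moreover have "countable ?S" unfolding julia_components_gens by simp
  ultimately have "bij_betw (to_nat_on ?S) ?S UNIV" by (rule to_nat_on_infinite[rotated])
  then show ?thesis unfolding eqpoll_def by blast
qed

lemma not_connected_julia_gens: "\<not> connected (julia_set (semigroup_generated gens))"
proof
  assume "connected (julia_set (semigroup_generated gens))"
  then have "\<exists>S. julia_components (semigroup_generated gens) \<subseteq> {S}"
    unfolding julia_components_def connected_eq_connected_components_eq by blast
  then have "finite (julia_components (semigroup_generated gens))"
    using finite_subset by blast
  then show False
    using julia_components_gens_eqpoll eqpoll_finite_iff infinite_UNIV_nat by blast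
qed

lemma vimage_sphere_subset_J_min:
  assumes "h = gen1 \<or> h = gen2"
  shows "sphere_map h -` (Pt ` sphere 0 4) \<subseteq> Pt ` julia_core"
proof
  fix x assume x: "x \<in> sphere_map h -` (Pt ` sphere 0 4)"
  then obtain z where z: "x = Pt z" "cmod (poly h z) = 4" by (cases x) auto
  then have "z \<in> level ([:0, 1:] \<circ>\<^sub>p h)" by (simp add: level_def pcompose_idL)
  then have "z \<in> seed" unfolding seed_def using assms gens_subset_monoid(4) by blast
  then show "x \<in> Pt ` julia_core"
    unfolding julia_core_def z(1) using subsetD[OF closure_subset] by blast
qed

theorem proposition2p28:
  "\<exists>h1 h2 h3 :: complex poly. \<exists>G.
     distinct [h1, h2, h3] \<and>
     G = semigroup_generated {h1, h2, h3} \<and>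
     G \<in> G_dis \<and>
     sphere_map h1 -` J_max G \<union> sphere_map h2 -` J_max G \<subseteq> J_min G \<and>
     J_max G = julia_set_of h3 \<and>
     julia_components G \<approx> (UNIV :: nat set) \<and>
     (\<exists>g\<in>G. \<exists>z0. superattracting_fixed_point g z0 \<and> z0 \<in> julia_set G) \<and>
     interior (J_min G) \<noteq> {}"
proof (intro exI conjI)
  let ?G = "semigroup_generated {gen1, gen2, gen3}"
  have G: "?G = semigroup_generated gens" by (simp add: gens_def)
  show "distinct [gen1, gen2, gen3]" using degree_gen by auto
  show "?G = semigroup_generated {gen1, gen2, gen3}" ..
  show "?G \<in> G_dis"
    unfolding G G_dis_def using gens_postcritically_bounded not_connected_julia_gens by blast
  show "sphere_map gen1 -` J_max ?G \<union> sphere_map gen2 -` J_max ?G \<subseteq> J_min ?G"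
    unfolding G J_max_gens J_min_gens using vimage_sphere_subset_J_min by blast
  show "J_max ?G = julia_set_of gen3"
    unfolding G J_max_gens julia_set_gen3 ..
  show "julia_components ?G \<approx> (UNIV :: nat set)"
    unfolding G by (rule julia_components_gens_eqpoll)
  have "1 \<in> planar_julia"
    using unit_circle_subset_julia_core[of 1] julia_core_subset by auto
  then have "superattracting_fixed_point gen1 (Pt 1) \<and> Pt 1 \<in> julia_set ?G"
    unfolding G julia_set_gens superattracting_fixed_point_def
    by (auto simp: poly_gen1 gen1_def pderiv_pCons)
  moreover have "gen1 \<in> ?G" by (intro semigroup_generated.generator) simp
  ultimately show "\<exists>g\<in>?G. \<exists>z0. superattracting_fixed_point g z0 \<and> z0 \<in> julia_set ?G" by blast
  \<comment> \<open>\<open>Pt\<close> is an open map, so interior points in the plane stay interior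
    on the sphere.\<close>
  have "Pt ` interior julia_core \<subseteq> interior (Pt ` julia_core)"
    by (intro interior_maximal open_Pt_image open_interior image_mono interior_subset)
  then show "interior (J_min ?G) \<noteq> {}"
    unfolding G J_min_gens using one_in_interior_julia_core by blast
qed

end
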